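(* Let $\bm C\in\mathbb S^d_{++}$, $\bm A=[\bm a_1,\dots,\bm a_n]\in\mathbb R^{d\times n}$, let $s$ be a positive integer with $s<n$, put $\bm b_i:=\bm C^{-1/2}\bm a_i$, $\bm B:=[\bm b_1,\dots,\bm b_n]$, let $\bm V^\top\bm V$ be the Cholesky factorization of $\bm I_n+\bm B^\top\bm B$, and let $\bm v_i\in\mathbb R^n$ be the $i$-th column of $\bm V$. The problem $$z^*=\log\det\bm C+\max_{\bm x\in\mathcal Z_s}\Big\{\log f_s\Big(\sum_{i\in[n]}x_i\bm v_i\bm v_i^\top\Big)\Big\}$$ is equivalent to $$z^*=\log\det(\bm C+\bm A\bm A^\top)+\max_{\bm x\in\mathcal Z_{n-s}}\Big\{\log f_{n-s}\Big(\sum_{i\in[n]}x_i\bm v_i\bm v_i^\top\Big)\Big\},$$ and the Lagrangian dual of the continuous relaxation of the latter is $$\hat z_M^c:=\log\det(\bm C+\bm A\bm A^\top)+\min_{\bm\Lambda\in\mathbb S^n_{++},\ \nu\in\mathbb R,\ \bm\mu\in\mathbb R^n_+}\Big\{-\log{\det}_{n-s}\bm\Lambda+(n-s)\nu+\sum_{i\in[n]}\mu_i-(n-s)\ :\ \bm v_i^\top\bm\Lambda\bm v_i\le\nu+\mu_i,\ i\in[n]\Big\}.$$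
   Context: $[n]=\{1,\dots,n\}$; $\mathbb S^n_{++}$ ($\mathbb S^n_+$) is the set of symmetric positive-definite (positive-semidefinite) $n\times n$ matrices; $\bm C^{-1/2}$ is the inverse of the positive-definite square root of $\bm C$; $\mathcal Z_k:=\{\bm x\in\{0,1\}^n:\sum_i x_i=k\}$; ${\det}_r(\bm\Lambda)$ is the product of the $r$ least eigenvalues of $\bm\Lambda$; the continuous relaxation replaces $\{0,1\}^n$ by $[0,1]^n$. The number $z^*$ is the optimal value $\max_{S\subseteq[n],|S|=s}\log\det(\bm C+\sum_{i\in S}\bm a_i\bm a_i^\top)$. For an integer $1\le r\le n$ and $\bm X\in\mathbb S^n_+$ with eigenvalues $\lambda_1\ge\cdots\ge\lambda_n\ge0$, $$f_r(\bm X)=\prod_{i=1}^k\lambda_i\times\Big(\frac1{r-k}\sum_{i=k+1}^n\lambda_i\Big)^{r-k},$$ where $k$ is the unique integer with $0\le k<r$ such that $\lambda_k>\frac1{r-k}\sum_{i=k+1}^n\lambda_i\ge\lambda_{k+1}$, with $\lambda_0=+\infty$. In the dual, $\nu$ is the multiplier of the constraint $\sum_i x_i=n-s$, $\bm\mu$ of the constraints $x_i\le1$, and $\bm\Lambda$ of $\sum_i x_i\bm v_i\bm v_i^\top\succeq\bm X$, where $\bm X$ is an auxiliary matrix variable with objective $\log f_{n-s}(\bm X)$.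
   Formalization: In the second formula for z*, the v_i are replaced by the columns w_i of W, with W^T W the Cholesky factorization of (I_n+B^T B)^{-1}; with v_i it is false (C=1, A=[1,1], s=1 gives ln 2 versus ln 3+ln 2). The dual formula is proved for both v_i and w_i. *)

theory Defs
  imports "HOL-Analysis.Analysis"
begin

section \<open>Symmetric matrices\<close>

definition psd :: "real^'n^'n \<Rightarrow> bool" where
  "psd X \<longleftrightarrow> transpose X = X \<and> (\<forall>x. 0 \<le> x \<bullet> (X *v x))"

definition pd :: "real^'n^'n \<Rightarrow> bool" where
  "pd X \<longleftrightarrow> transpose X = X \<and> (\<forall>x. x \<noteq> 0 \<longrightarrow> 0 < x \<bullet> (X *v x))"

definition inv_sqrt :: "real^'n^'n \<Rightarrow> real^'n^'n" where
  "inv_sqrt C = matrix_inv (THE R. pd R \<and> R ** R = C)"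

text \<open>The order on the index type is what gives meaning to "triangular".\<close>

definition cholesky_factor :: "real^('n::{finite,linorder})^('n::{finite,linorder}) \<Rightarrow> real^('n::{finite,linorder})^('n::{finite,linorder}) \<Rightarrow> bool" where
  "cholesky_factor V M \<longleftrightarrow>
     (\<forall>i j. j < i \<longrightarrow> V $ i $ j = 0) \<and> (\<forall>i. 0 < V $ i $ i) \<and> transpose V ** V = M"

text \<open>Eigenvalues with multiplicity, in non-increasing order, read off from the factorization of
  the characteristic polynomial. Unspecified if that polynomial does not split over the reals; for
  symmetric matrices it does.\<close>

definition eigenvalue_list :: "real^'n^'n \<Rightarrow> real list" where
  "eigenvalue_list X = (THE l. length l = CARD('n) \<and> sorted_wrt (\<ge>) l \<and>
     (\<forall>t. det (mat t - X) = (\<Prod>e\<leftarrow>l. t - e)))"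

text \<open>Indices are 1-based: \<open>eig X 1\<close> is the largest and \<open>eig X CARD('n)\<close> the least eigenvalue.\<close>

definition eig :: "real^'n^'n \<Rightarrow> nat \<Rightarrow> real" where
  "eig X i = eigenvalue_list X ! (i - 1)"

definition det_least :: "nat \<Rightarrow> real^'n^'n \<Rightarrow> real" where
  "det_least r \<Lambda> = (\<Prod>i = CARD('n) - r + 1..CARD('n). eig \<Lambda> i)"


section \<open>The spectral function and the combinatorial problems\<close>

definition tail_mean :: "nat \<Rightarrow> real^'n^'n \<Rightarrow> nat \<Rightarrow> real" where
  "tail_mean r X k = (\<Sum>i = k + 1..CARD('n). eig X i) / real (r - k)"

text \<open>The guard \<open>0 < k\<close> implements the convention that the zeroth eigenvalue is infinite.\<close>

definition split_index :: "nat \<Rightarrow> real^'n^'n \<Rightarrow> nat" where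
  "split_index r X = (THE k. k < r \<and> (0 < k \<longrightarrow> tail_mean r X k < eig X k) \<and>
     eig X (k + 1) \<le> tail_mean r X k)"

definition f_spec :: "nat \<Rightarrow> real^'n^'n \<Rightarrow> real" where
  "f_spec r X = (let k = split_index r X in
     (\<Prod>i = 1..k. eig X i) * tail_mean r X k ^ (r - k))"

text \<open>The logarithm takes the value \<open>-\<infinity>\<close> at 0, unlike \<^const>\<open>ln\<close>.\<close>

definition log_f :: "nat \<Rightarrow> real^'n^'n \<Rightarrow> ereal" where
  "log_f r X = (if 0 < f_spec r X then ereal (ln (f_spec r X)) else -\<infinity>)"

definition outer :: "real^'d \<Rightarrow> real^'d^'d" where
  "outer v = (columnvector v :: real^1^'d) ** rowvector v"

definition weighted_outer :: "real^'n^'d \<Rightarrow> real^'n \<Rightarrow> real^'d^'d" where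
  "weighted_outer V x = (\<Sum>i\<in>UNIV. x $ i *\<^sub>R outer (column i V))"

definition z_star :: "real^'d^'d \<Rightarrow> real^'n^'d \<Rightarrow> nat \<Rightarrow> real" where
  "z_star C A s =
     Max ((\<lambda>S. ln (det (C + (\<Sum>i\<in>S. outer (column i A))))) ` {S. card S = s})"

definition Z_set :: "nat \<Rightarrow> (real^'n) set" where
  "Z_set k = {x. (\<forall>i. x $ i \<in> {0, 1}) \<and> (\<Sum>i\<in>UNIV. x $ i) = real k}"


section \<open>Continuous relaxation and Lagrangian dual\<close>

text \<open>In this section \<open>c\<close> is an additive constant of the objective.\<close>

definition relaxed_set :: "nat \<Rightarrow> (real^'n) set" where
  "relaxed_set r = {x. (\<forall>i. x $ i \<in> {0..1}) \<and> (\<Sum>i\<in>UNIV. x $ i) = real r}"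

definition relaxation :: "real \<Rightarrow> nat \<Rightarrow> real^'n^'n \<Rightarrow> ereal" where
  "relaxation c r V = (SUP x\<in>relaxed_set r. ereal c + log_f r (weighted_outer V x))"

text \<open>The same problem with an auxiliary matrix variable below the weighted sum; this is the form
  that is dualized.\<close>

definition lifted_relaxation :: "real \<Rightarrow> nat \<Rightarrow> real^'n^'n \<Rightarrow> ereal" where
  "lifted_relaxation c r V =
     (SUP (x, X)\<in>{(x, X). x \<in> relaxed_set r \<and> psd X \<and> psd (weighted_outer V x - X)}.
        ereal c + log_f r X)"

text \<open>Multipliers: \<open>\<Lambda>\<close> for the semidefinite constraint, \<open>\<nu>\<close> for the cardinality constraint and
  \<open>\<mu>\<close> for the upper bounds. The constraints \<open>x \<ge> 0\<close> and \<open>psd X\<close> are not dualized.\<close>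

definition lagrangian ::
    "real \<Rightarrow> nat \<Rightarrow> real^'n^'n \<Rightarrow> (real^'n) \<times> (real^'n^'n) \<Rightarrow> (real^'n^'n) \<times> real \<times> (real^'n) \<Rightarrow> ereal" where
  "lagrangian c r V = (\<lambda>(x, X) (\<Lambda>, \<nu>, \<mu>).
     ereal c + log_f r X +
     ereal (trace (\<Lambda> ** (weighted_outer V x - X)) + \<nu> * (real r - (\<Sum>i\<in>UNIV. x $ i)) +
            (\<Sum>i\<in>UNIV. \<mu> $ i * (1 - x $ i))))"

definition dual_function ::
    "real \<Rightarrow> nat \<Rightarrow> real^'n^'n \<Rightarrow> (real^'n^'n) \<times> real \<times> (real^'n) \<Rightarrow> ereal" where
  "dual_function c r V p = (SUP y\<in>{(x, X). (\<forall>i. 0 \<le> x $ i) \<and> psd X}. lagrangian c r V y p)"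

definition multipliers :: "((real^'n^'n) \<times> real \<times> (real^'n)) set" where
  "multipliers = {(\<Lambda>, \<nu>, \<mu>). psd \<Lambda> \<and> (\<forall>i. 0 \<le> \<mu> $ i)}"

definition lagrangian_dual :: "real \<Rightarrow> nat \<Rightarrow> real^'n^'n \<Rightarrow> ereal" where
  "lagrangian_dual c r V = (INF p\<in>multipliers. dual_function c r V p)"

definition dual_feasible :: "real^'n^'n \<Rightarrow> ((real^'n^'n) \<times> real \<times> (real^'n)) set" where
  "dual_feasible V = {(\<Lambda>, \<nu>, \<mu>). pd \<Lambda> \<and> (\<forall>i. 0 \<le> \<mu> $ i) \<and>
     (\<forall>i. column i V \<bullet> (\<Lambda> *v column i V) \<le> \<nu> + \<mu> $ i)}"

definition dual_objective :: "nat \<Rightarrow> (real^'n^'n) \<times> real \<times> (real^'n) \<Rightarrow> real" where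
  "dual_objective r = (\<lambda>(\<Lambda>, \<nu>, \<mu>).
     - ln (det_least r \<Lambda>) + real r * \<nu> + (\<Sum>i\<in>UNIV. \<mu> $ i) - real r)"

text \<open>Complementing the index set uses \<open>det M[S,S] = det M * det (inverse M)[T,T]\<close>, where \<open>T\<close> is the
  complement of \<open>S\<close>. The complementary problem therefore needs the Cholesky factor \<open>W\<close> of the
  inverse of \<open>M = I + transpose B ** B\<close>, not the factor \<open>V\<close> of \<open>M\<close>. With \<open>V\<close> in its place the
  identity fails: for \<open>C = 1\<close>, \<open>A = [1, 1]\<close> and \<open>s = 1\<close> the optimal value is \<open>ln 2\<close>, but the formula
  with \<open>V\<close> gives \<open>ln 3 + ln 2\<close>. The dual formula holds for either factor.\<close>

end

theory Submission
  imports Defs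
begin

text \<open>Weak duality: if \<open>q\<^sub>1, \<dots>, q\<^sub>n\<close> is an eigenbasis of \<open>X\<close> and \<open>a\<^sub>j\<close> are the diagonal
  entries of \<open>\<Lambda>\<close> in it, then any \<open>r\<close> of the \<open>a\<^sub>j\<close> have product at least \<open>det\<^sub>r \<Lambda>\<close>. Taking the first
  \<open>k\<close> of them and the \<open>r - k\<close> least of the others, where \<open>k\<close> is the split index of \<open>X\<close>, the inequality
  \<open>log t \<le> t - 1\<close> gives \<open>log f\<^sub>r(X) \<le> tr (\<Lambda> X) - log det\<^sub>r \<Lambda> - r\<close>. For fixed \<open>X\<close> the right-hand side
  has infimum \<open>log f\<^sub>r(X)\<close>, so \<open>f\<^sub>r\<close> is monotone in the semidefinite order; for fixed \<open>\<Lambda>\<close> equality is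
  attained at a matrix \<open>X\<close> of rank \<open>r\<close>, which evaluates the dual function and shows that the dual
  objective is lower semicontinuous. Its sublevel sets are compact, so a minimizer exists.

  For a 0/1 vector with support \<open>S\<close> of size \<open>s\<close> the matrix \<open>\<Sum>\<^sub>i x\<^sub>i v\<^sub>i v\<^sub>i\<^sup>T\<close> has rank \<open>s\<close>, so \<open>f\<^sub>s\<close> is the
  product of its nonzero eigenvalues, which is the principal minor of \<open>V\<^sup>T V\<close> on \<open>S\<close>. The
  equivalence of the two problems is then Jacobi's identity for complementary minors.\<close>

section \<open>The spectral theorem\<close>

text \<open>Compactness of the sublevel sets is where linear independence of the \<open>v_i\<close>
  and \<open>r < n\<close> enter. Summing the constraints over \<open>i\<close> bounds a positive
  multiple of \<open>tr \<Lambda>\<close> by \<open>n * \<nu> + \<Sum> \<mu>_i\<close>, because the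
  \<open>v_i\<close> span. As \<open>r < n\<close>, the linear part of the objective then controls
  \<open>tr \<Lambda>\<close> and \<open>\<Sum> \<mu>_i\<close> at once, while
  \<open>log det_r\<close> grows only logarithmically. The cone of positive definite matrices is not
  closed, so the least eigenvalue must also be kept away from 0; the term \<open>- log det_r\<close>
  does this. Two choices keep the rest elementary. \<open>eig\<close> rests on a definite
  description of a list, so no continuity of eigenvalues is used: spectral quantities are read off
  from orthonormal eigenbases, and lower semicontinuity takes the form of continuous minorants
  touching the objective at a given point. Submatrices would need a type for each index set, so they
  are replaced by full matrices padded by means of the coordinate projections
  \<open>sel S\<close>.\<close>

definition orthonormal :: "(nat \<Rightarrow> 'a::real_inner) \<Rightarrow> nat set \<Rightarrow> bool" where
  "orthonormal q I \<longleftrightarrow> (\<forall>i\<in>I. \<forall>j\<in>I. q i \<bullet> q j = (if i = j then 1 else 0))"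

text \<open>Indexing by naturals instead of \<open>'n\<close> makes an order of the eigenvalues
  expressible; sortedness is a separate condition, and values outside \<open>{1..CARD('n)}\<close>
  are arbitrary.\<close>

definition eigenbasis :: "real^'n^'n \<Rightarrow> (nat \<Rightarrow> real) \<Rightarrow> (nat \<Rightarrow> real^'n) \<Rightarrow> bool" where
  "eigenbasis X l q \<longleftrightarrow>
     orthonormal q {1..CARD('n)} \<and> (\<forall>i\<in>{1..CARD('n)}. X *v q i = l i *\<^sub>R q i)"

lemma symmetric_inner:
  fixes X :: "real^'n^'n"
  assumes "transpose X = X"
  shows "x \<bullet> (X *v y) = (X *v x) \<bullet> y"
  by (metis assms dot_lmul_matrix transpose_matrix_vector)

lemma linear_le_quadratic_imp_zero:
  fixes a b :: real
  assumes "\<And>t. t * a \<le> t\<^sup>2 * b"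
  shows "a = 0"
proof (rule ccontr)
  assume "a \<noteq> 0"
  \<comment> \<open>With this \<open>t\<close> both sides are multiples of
    \<open>a\<^sup>2 / (|b| + 1)\<close>, the left one with factor 1 and the right one with a factor
    below 1.\<close>
  define t where "t = a / (\<bar>b\<bar> + 1)"
  have "t * a = a\<^sup>2 / (\<bar>b\<bar> + 1)" by (simp add: t_def power2_eq_square)
  moreover have "t\<^sup>2 * b = (a\<^sup>2 / (\<bar>b\<bar> + 1)) * (b / (\<bar>b\<bar> + 1))"
    by (simp add: t_def power2_eq_square)
  moreover have "b / (\<bar>b\<bar> + 1) < 1" by (simp add: field_simps)
  moreover have "0 < a\<^sup>2 / (\<bar>b\<bar> + 1)" using \<open>a \<noteq> 0\<close> by (simp add: add_pos_nonneg)
  ultimately show False using assms[of t] mult_strict_left_mono[of "b / (\<bar>b\<bar> + 1)" 1 "a\<^sup>2 / (\<bar>b\<bar> + 1)"]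
    by simp
qed

text \<open>The residual \<open>w = X v - l v\<close> lies in \<open>E\<close> and is orthogonal to
  \<open>v\<close>. Moving from \<open>v\<close> by \<open>t w\<close> changes the two sides of the
  Rayleigh inequality by a first-order term \<open>2 t (w \<bullet> X v)\<close> against
  second-order ones, so \<open>w \<bullet> X v\<close> vanishes; and it equals
  \<open>w \<bullet> w\<close>.\<close>

lemma Rayleigh_maximizer_eigenvector:
  fixes X :: "real^'n^'n"
  assumes sym: "transpose X = X" and "norm v = 1" and "v \<in> E"
    and E: "subspace E" "\<And>x. x \<in> E \<Longrightarrow> X *v x \<in> E"
    and max: "\<And>x. x \<in> E \<Longrightarrow> x \<bullet> (X *v x) \<le> l * (x \<bullet> x)"
    and l: "v \<bullet> (X *v v) = l"
  shows "X *v v = l *\<^sub>R v"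
proof -
  have vv: "v \<bullet> v = 1" using \<open>norm v = 1\<close> by (simp add: norm_eq_1)
  define w where "w = X *v v - l *\<^sub>R v"
  have wE: "w \<in> E" unfolding w_def using E \<open>v \<in> E\<close> by (simp add: subspace_diff subspace_scale)
  have wv: "w \<bullet> v = 0" unfolding w_def using l vv by (simp add: inner_diff inner_commute)
  have "t * (2 * (w \<bullet> (X *v v))) \<le> t\<^sup>2 * (l * (w \<bullet> w) - w \<bullet> (X *v w))" for t
  proof -
    have sw: "v \<bullet> (X *v w) = w \<bullet> (X *v v)" using symmetric_inner[OF sym, of v w] by (simp add: inner_commute)
    have "v + t *\<^sub>R w \<in> E" using E \<open>v \<in> E\<close> wE by (simp add: subspace_add subspace_scale)
    from max[OF this] have "(v + t *\<^sub>R w) \<bullet> (X *v (v + t *\<^sub>R w)) \<le> l * ((v + t *\<^sub>R w) \<bullet> (v + t *\<^sub>R w))" .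
    moreover have "(v + t *\<^sub>R w) \<bullet> (X *v (v + t *\<^sub>R w)) =
       l + t * (2 * (w \<bullet> (X *v v))) + t\<^sup>2 * (w \<bullet> (X *v w))"
      by (simp add: matrix_vector_right_distrib matrix_vector_mult_scaleR inner_add_left inner_add_right
          sw l power2_eq_square algebra_simps)
    moreover have "(v + t *\<^sub>R w) \<bullet> (v + t *\<^sub>R w) = 1 + t\<^sup>2 * (w \<bullet> w)"
      using wv vv by (simp add: inner_add_left inner_add_right inner_commute power2_eq_square)
    ultimately have "l + t * (2 * (w \<bullet> (X *v v))) + t\<^sup>2 * (w \<bullet> (X *v w)) \<le> l * (1 + t\<^sup>2 * (w \<bullet> w))"
      by simp
    then show ?thesis by (simp add: algebra_simps)
  qed
  then have "2 * (w \<bullet> (X *v v)) = 0" by (rule linear_le_quadratic_imp_zero)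
  then have "w \<bullet> w = 0" using wv unfolding w_def by (simp add: inner_diff_right)
  then show ?thesis by (simp add: w_def)
qed

text \<open>Deflation: the next eigenvector maximizes the Rayleigh quotient on the orthogonal
  complement of the previous ones, which \<open>X\<close> leaves invariant. The Rayleigh bound is
  carried through the induction because the order of the eigenvalues is later read off from
  it.\<close>

lemma partial_eigenbasis_exists:
  fixes X :: "real^'n^'n"
  assumes sym: "transpose X = X"
  shows "k \<le> CARD('n) \<Longrightarrow> \<exists>q l. orthonormal q {1..k} \<and> (\<forall>i\<in>{1..k}. X *v q i = l i *\<^sub>R q i) \<and>
     (\<forall>i\<in>{1..k}. \<forall>x. (\<forall>j\<in>{1..<i}. q j \<bullet> x = 0) \<longrightarrow> x \<bullet> (X *v x) \<le> l i * (x \<bullet> x))"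
proof (induction k)
  case 0
  then show ?case by (auto simp: orthonormal_def)
next
  case (Suc k)
  then obtain q l where on: "orthonormal q {1..k}" and eig: "\<And>i. i \<in> {1..k} \<Longrightarrow> X *v q i = l i *\<^sub>R q i"
    and ray: "\<And>i x. i \<in> {1..k} \<Longrightarrow> (\<forall>j\<in>{1..<i}. q j \<bullet> x = 0) \<Longrightarrow> x \<bullet> (X *v x) \<le> l i * (x \<bullet> x)"
    by (metis Suc_leD)
  define E where "E = {x. \<forall>j\<in>{1..k}. q j \<bullet> x = 0}"
  have E: "subspace E" by (auto simp: E_def subspace_def inner_add_right)
  have XE: "X *v x \<in> E" if "x \<in> E" for x
    using that eig by (auto simp: E_def symmetric_inner[OF sym])
  define S where "S = sphere 0 1 \<inter> E"
  have "closed E" using E by (rule closed_subspace)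
  then have "compact S" unfolding S_def by (simp add: compact_Int_closed)
  have "dim (q ` {1..k}) \<le> card (q ` {1..k})" by (simp add: dim_le_card')
  also have "\<dots> \<le> k" using card_image_le[of "{1..k}" q] by simp
  also have "\<dots> < DIM(real^'n)" using Suc.prems by simp
  finally obtain z where z: "z \<noteq> 0" "\<And>y. y \<in> span (q ` {1..k}) \<Longrightarrow> orthogonal z y"
    using orthogonal_to_subspace_exists[of "q ` {1..k}"] by metis
  have "z \<in> E" unfolding E_def
    using z(2)[OF span_base] by (auto simp: orthogonal_def inner_commute[of z])
  then have "(1 / norm z) *\<^sub>R z \<in> S" using z(1) E by (simp add: S_def subspace_scale)
  then have "S \<noteq> {}" by auto
  have "continuous_on S (\<lambda>x. x \<bullet> (X *v x))"
    by (intro continuous_intros linear_continuous_on) (simp add: linear_linear)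
  with \<open>compact S\<close> \<open>S \<noteq> {}\<close> obtain v where v: "v \<in> S" "\<And>x. x \<in> S \<Longrightarrow> x \<bullet> (X *v x) \<le> v \<bullet> (X *v v)"
    by (metis continuous_attains_sup)
  define m where "m = v \<bullet> (X *v v)"
  have vn: "norm v = 1" and vE: "v \<in> E" using v(1) by (auto simp: S_def)
  have max: "x \<bullet> (X *v x) \<le> m * (x \<bullet> x)" if "x \<in> E" for x
  proof (cases "x = 0")
    case False
    define y where "y = (1 / norm x) *\<^sub>R x"
    have "y \<in> S" using that False E by (simp add: S_def y_def subspace_scale)
    then have "y \<bullet> (X *v y) \<le> m" using v by (simp add: m_def)
    moreover have "x = norm x *\<^sub>R y" using False by (simp add: y_def)
    then have "x \<bullet> (X *v x) = (norm x)\<^sup>2 * (y \<bullet> (X *v y))"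
      by (metis inner_scaleR_left inner_scaleR_right matrix_vector_mult_scaleR mult.assoc power2_eq_square)
    ultimately have "x \<bullet> (X *v x) \<le> (norm x)\<^sup>2 * m" by (simp add: mult_left_mono)
    then show ?thesis by (simp add: power2_norm_eq_inner mult.commute)
  qed simp
  have Xv: "X *v v = m *\<^sub>R v"
    by (rule Rayleigh_maximizer_eigenvector[OF sym vn vE E XE max]) (simp_all add: m_def)
  let ?q = "q(Suc k := v)" and ?l = "l(Suc k := m)"
  have "orthonormal ?q {1..Suc k}"
    using on vE vn by (auto simp: orthonormal_def E_def norm_eq_1 inner_commute)
  moreover have "\<forall>i\<in>{1..Suc k}. X *v ?q i = ?l i *\<^sub>R ?q i"
    using eig Xv by auto
  moreover have "x \<bullet> (X *v x) \<le> ?l i * (x \<bullet> x)" if "i \<in> {1..Suc k}" "\<forall>j\<in>{1..<i}. ?q j \<bullet> x = 0" for i x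
  proof (cases "i = Suc k")
    case True
    then have "x \<in> E" using that(2) by (force simp: E_def)
    then show ?thesis using max True by simp
  next
    case False
    then have "i \<in> {1..k}" and "\<forall>j\<in>{1..<i}. q j \<bullet> x = 0" using that by auto
    then show ?thesis using ray False by simp
  qed
  ultimately show ?case by blast
qed

lemma sorted_eigenbasis_exists:
  fixes X :: "real^'n^'n"
  assumes sym: "transpose X = X"
  obtains q l where "eigenbasis X l q" "\<And>i j. 1 \<le> i \<Longrightarrow> i \<le> j \<Longrightarrow> j \<le> CARD('n) \<Longrightarrow> l j \<le> l i"
proof -
  obtain q l where on: "orthonormal q {1..CARD('n)}"
    and eig: "\<And>i. i \<in> {1..CARD('n)} \<Longrightarrow> X *v q i = l i *\<^sub>R q i"
    and ray: "\<And>i x. i \<in> {1..CARD('n)} \<Longrightarrow> (\<forall>j\<in>{1..<i}. q j \<bullet> x = 0) \<Longrightarrow> x \<bullet> (X *v x) \<le> l i * (x \<bullet> x)"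
    using partial_eigenbasis_exists[OF sym order_refl] by blast
  have "l j \<le> l i" if "1 \<le> i" "i \<le> j" "j \<le> CARD('n)" for i j
  proof -
    have "q j \<bullet> (X *v q j) \<le> l i * (q j \<bullet> q j)"
      using that on by (intro ray) (auto simp: orthonormal_def)
    then show ?thesis using that eig[of j] on by (auto simp: orthonormal_def)
  qed
  moreover have "eigenbasis X l q" using on eig by (auto simp: eigenbasis_def)
  ultimately show ?thesis using that by blast
qed

section \<open>Expansions in an orthonormal basis\<close>

lemma orthonormal_reindex:
  fixes q :: "nat \<Rightarrow> real^'n"
  assumes "orthonormal q {1..CARD('n)}"
  obtains e :: "'n \<Rightarrow> nat" and Q :: "real^'n^'n"
  where "bij_betw e UNIV {1..CARD('n)}" "\<And>j. column j Q = q (e j)" "orthogonal_matrix Q"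
proof -
  obtain e :: "'n \<Rightarrow> nat" where e: "bij_betw e UNIV {1..CARD('n)}"
    using finite_same_card_bij[of "UNIV :: 'n set" "{1..CARD('n)}"] by auto
  define Q :: "real^'n^'n" where "Q = (\<chi> i j. q (e j) $ i)"
  have col: "column j Q = q (e j)" for j by (simp add: column_def Q_def vec_eq_iff)
  have "e i \<in> {1..CARD('n)}" for i using e by (auto simp: bij_betw_def)
  moreover have "e i = e j \<longleftrightarrow> i = j" for i j using e by (auto simp: bij_betw_def inj_on_def)
  ultimately have "transpose Q ** Q = mat 1"
    using assms by (simp add: matrix_mult_transpose_dot_column col orthonormal_def mat_def vec_eq_iff)
  then have "orthogonal_matrix Q" by (simp add: orthogonal_matrix)
  then show ?thesis using that e col by blast
qed

lemma orthonormal_sum_outer: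
  fixes q :: "nat \<Rightarrow> real^'n"
  assumes "orthonormal q {1..CARD('n)}"
  shows "x = (\<Sum>i\<in>{1..CARD('n)}. (q i \<bullet> x) *\<^sub>R q i)"
proof -
  obtain e :: "'n \<Rightarrow> nat" and Q :: "real^'n^'n"
    where e: "bij_betw e UNIV {1..CARD('n)}" and col: "\<And>j. column j Q = q (e j)" and Q: "orthogonal_matrix Q"
    using orthonormal_reindex[OF assms] by metis
  have c: "(transpose Q *v x) $ j = q (e j) \<bullet> x" for j
    by (simp add: col[symmetric] matrix_vector_mul_component transpose_def column_def del: transpose_matrix_vector)
  have "x = Q *v (transpose Q *v x)"
    using Q by (simp add: matrix_vector_mul_assoc orthogonal_matrix_def del: transpose_matrix_vector)
  also have "\<dots> = (\<Sum>j\<in>UNIV. (q (e j) \<bullet> x) *\<^sub>R q (e j))"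
    by (subst matrix_mult_sum) (simp add: c col scalar_mult_eq_scaleR del: transpose_matrix_vector)
  also have "\<dots> = (\<Sum>i\<in>{1..CARD('n)}. (q i \<bullet> x) *\<^sub>R q i)"
    by (rule sum.reindex_bij_betw[OF e])
  finally show ?thesis .
qed

lemma orthonormal_inner:
  fixes q :: "nat \<Rightarrow> real^'n"
  assumes "orthonormal q {1..CARD('n)}"
  shows "x \<bullet> y = (\<Sum>i\<in>{1..CARD('n)}. (q i \<bullet> x) * (q i \<bullet> y))"
  using arg_cong[OF orthonormal_sum_outer[OF assms, of x], of "\<lambda>z. z \<bullet> y"]
  by (simp add: inner_sum_left)

lemma trace_orthonormal:
  fixes q :: "nat \<Rightarrow> real^'n" and X :: "real^'n^'n"
  assumes "orthonormal q {1..CARD('n)}"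
  shows "trace X = (\<Sum>i\<in>{1..CARD('n)}. q i \<bullet> (X *v q i))"
proof -
  have "trace X = (\<Sum>k\<in>UNIV. axis k 1 \<bullet> (X *v axis k 1))"
    by (simp add: trace_def inner_axis' matrix_vector_mult_basis column_def)
  also have "\<dots> = (\<Sum>k\<in>UNIV. \<Sum>i\<in>{1..CARD('n)}. (q i \<bullet> axis k 1) * (q i \<bullet> (X *v axis k 1)))"
    by (subst orthonormal_inner[OF assms]) simp
  also have "\<dots> = (\<Sum>i\<in>{1..CARD('n)}. \<Sum>k\<in>UNIV. (q i \<bullet> axis k 1) * (q i \<bullet> (X *v axis k 1)))"
    by (rule sum.swap)
  also have "\<dots> = (\<Sum>i\<in>{1..CARD('n)}. q i \<bullet> (X *v q i))"
  proof (rule sum.cong[OF refl])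
    fix i
    have "q i \<bullet> (X *v q i) = (q i v* X) \<bullet> q i" by (simp add: dot_lmul_matrix)
    then have "q i \<bullet> (X *v q i) = (\<Sum>k\<in>UNIV. (q i v* X) $ k * q i $ k)" by (simp add: inner_vec_def)
    then show "(\<Sum>k\<in>UNIV. (q i \<bullet> axis k 1) * (q i \<bullet> (X *v axis k 1))) = q i \<bullet> (X *v q i)"
      by (simp add: dot_lmul_matrix[symmetric] inner_axis mult.commute)
  qed
  finally show ?thesis .
qed

text \<open>The matrix of eigenvectors conjugates to a diagonal matrix. Both parameters are kept so
  that one statement covers the characteristic polynomial (\<open>k = -1\<close>),
  \<open>det (I + X)\<close> and \<open>det X\<close>.\<close>

lemma eigenbasis_det:
  fixes X :: "real^'n^'n"
  assumes "eigenbasis X l q"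
  shows "det (mat t + k *\<^sub>R X) = (\<Prod>i\<in>{1..CARD('n)}. t + k * l i)"
proof -
  have on: "orthonormal q {1..CARD('n)}" using assms by (simp add: eigenbasis_def)
  obtain e :: "'n \<Rightarrow> nat" and Q :: "real^'n^'n"
    where e: "bij_betw e UNIV {1..CARD('n)}" and col: "\<And>j. column j Q = q (e j)" and Q: "orthogonal_matrix Q"
    using orthonormal_reindex[OF on] by metis
  define D :: "real^'n^'n" where "D = (\<chi> i j. if i = j then t + k * l (e j) else 0)"
  have "(mat t + k *\<^sub>R X) ** Q = Q ** D"
  proof -
    have "column j ((mat t + k *\<^sub>R X) ** Q) = column j (Q ** D)" for j
    proof -
      have "e j \<in> {1..CARD('n)}" using e by (auto simp: bij_betw_def)
      then have Xq: "X *v q (e j) = l (e j) *\<^sub>R q (e j)" using assms by (simp add: eigenbasis_def)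
      have mt: "mat t *v x = t *\<^sub>R x" for x :: "real^'n"
        by (simp add: matrix_vector_mult_def mat_def vec_eq_iff if_distrib[of "\<lambda>z. z * _"] cong: if_cong)
      have "column j ((mat t + k *\<^sub>R X) ** Q) = (mat t + k *\<^sub>R X) *v column j Q"
        by (simp add: column_def matrix_matrix_mult_def matrix_vector_mult_def)
      also have "\<dots> = (t + k * l (e j)) *\<^sub>R q (e j)"
        by (simp add: matrix_vector_mult_add_rdistrib col mt scaleR_matrix_vector_assoc[symmetric] Xq algebra_simps)
      also have "\<dots> = column j (Q ** D)"
        unfolding col[symmetric]
        by (simp add: column_def matrix_matrix_mult_def D_def vec_eq_iff if_distrib[of "\<lambda>z. _ * z"] cong: if_cong)
      finally show ?thesis .
    qed
    then show ?thesis by (simp add: column_def vec_eq_iff)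
  qed
  then have "det (mat t + k *\<^sub>R X) * det Q = det Q * det D" by (metis det_mul)
  moreover have "det Q \<noteq> 0" using det_orthogonal_matrix[OF Q] by auto
  ultimately have "det (mat t + k *\<^sub>R X) = det D" by simp
  also have "\<dots> = (\<Prod>j\<in>UNIV. t + k * l (e j))" by (subst det_diagonal) (simp_all add: D_def)
  also have "\<dots> = (\<Prod>i\<in>{1..CARD('n)}. t + k * l i)" by (rule prod.reindex_bij_betw[OF e])
  finally show ?thesis .
qed

text \<open>Equal polynomial functions over the reals come from equal polynomials, whose roots form
  one multiset; a sorted list is determined by its multiset.\<close>

lemma sorted_roots_unique:
  fixes l m :: "real list"
  assumes "sorted_wrt (\<ge>) l" "sorted_wrt (\<ge>) m" "\<And>t. (\<Prod>e\<leftarrow>l. t - e) = (\<Prod>e\<leftarrow>m. t - e)"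
  shows "l = m"
proof -
  define P where "P l = (\<Prod>e\<leftarrow>l. [:- e, 1:])" for l :: "real list"
  have "poly (P l) t = (\<Prod>e\<leftarrow>l. t - e)" for l t
    unfolding P_def by (induction l) (auto simp: algebra_simps)
  then have "poly (P l) = poly (P m)" using assms(3) by auto
  then have "P l = P m" by (simp add: poly_eq_poly_eq_iff)
  moreover have "proots (P l) = mset l" for l
  proof (induction l)
    case (Cons a l)
    have "P l \<noteq> 0" unfolding P_def by (auto simp: prod_list_zero_iff)
    then have "proots ([:- a, 1:] * P l) = proots [:- a, 1:] + proots (P l)"
      by (intro proots_mult) auto
    then show ?case using Cons by (simp add: P_def)
  qed (simp add: P_def)
  ultimately have "mset l = mset m" by metis
  then have "mset (rev l) = mset (rev m)" by simp
  moreover have "sorted (rev l)" "sorted (rev m)" using assms(1,2) by (simp_all add: sorted_wrt_rev)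
  ultimately have "rev l = rev m" by (metis properties_for_sort)
  then show ?thesis by simp
qed

text \<open>The only place where the definite description behind \<open>eig\<close> is resolved.
  Explicitly constructed matrices get their eigenvalues through it.\<close>

lemma eig_eqI:
  fixes X :: "real^'n^'n"
  assumes eb: "eigenbasis X l q" and srt: "\<And>i j. 1 \<le> i \<Longrightarrow> i \<le> j \<Longrightarrow> j \<le> CARD('n) \<Longrightarrow> l j \<le> l i"
    and i: "i \<in> {1..CARD('n)}"
  shows "eig X i = l i"
proof -
  let ?L = "map l [1..<Suc (CARD('n))]"
  have d: "det (mat t - X) = (\<Prod>e\<leftarrow>?L. t - e)" for t
  proof -
    have "det (mat t - X) = (\<Prod>i\<in>{1..CARD('n)}. t - l i)"
      using eigenbasis_det[OF eb, of t "-1"] by simp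
    also have "\<dots> = prod_list (map (\<lambda>i. t - l i) [1..<Suc (CARD('n))])"
      by (subst prod.distinct_set_conv_list[symmetric])
        (auto simp: atLeastLessThanSuc_atLeastAtMost simp del: upt_Suc)
    finally show ?thesis by (simp add: comp_def)
  qed
  have s: "sorted_wrt (\<ge>) ?L"
    unfolding sorted_wrt_iff_nth_less using srt by (auto simp del: upt_Suc)
  have "eigenvalue_list X = ?L" unfolding eigenvalue_list_def
  proof (rule the_equality)
    show "length ?L = CARD('n) \<and> sorted_wrt (\<ge>) ?L \<and> (\<forall>t. det (mat t - X) = (\<Prod>e\<leftarrow>?L. t - e))"
      using d s by (simp del: upt_Suc)
  next
    fix m assume "length m = CARD('n) \<and> sorted_wrt (\<ge>) m \<and> (\<forall>t. det (mat t - X) = (\<Prod>e\<leftarrow>m. t - e))"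
    then show "m = ?L" using d s by (intro sorted_roots_unique) auto
  qed
  then show ?thesis using i by (simp add: eig_def del: upt_Suc) (auto simp del: upt_Suc)
qed

lemma eig_sorted:
  fixes X :: "real^'n^'n"
  assumes "transpose X = X"
  obtains q where "eigenbasis X (eig X) q" "\<And>i j. 1 \<le> i \<Longrightarrow> i \<le> j \<Longrightarrow> j \<le> CARD('n) \<Longrightarrow> eig X j \<le> eig X i"
proof -
  obtain q l where eb: "eigenbasis X l q" and s: "\<And>i j. 1 \<le> i \<Longrightarrow> i \<le> j \<Longrightarrow> j \<le> CARD('n) \<Longrightarrow> l j \<le> l i"
    using sorted_eigenbasis_exists[OF assms] by metis
  have "eig X i = l i" if "i \<in> {1..CARD('n)}" for i using eig_eqI[OF eb s that] .
  then have "eigenbasis X (eig X) q" and "\<And>i j. 1 \<le> i \<Longrightarrow> i \<le> j \<Longrightarrow> j \<le> CARD('n) \<Longrightarrow> eig X j \<le> eig X i"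
    using eb s by (auto simp: eigenbasis_def)
  then show ?thesis using that by blast
qed

section \<open>Rank-one matrices and matrices with prescribed spectrum\<close>

lemma outer_mult: "outer v *v x = (v \<bullet> x) *\<^sub>R v"
  by (simp add: outer_def matrix_matrix_mult_def columnvector_def rowvector_def
      matrix_vector_mult_def inner_vec_def vec_eq_iff sum_distrib_left mult_ac)

lemma transpose_outer: "transpose (outer v) = outer v"
  by (simp add: outer_def matrix_transpose_mul transpose_columnvector transpose_rowvector)

lemma sum_matrix_vector_mult:
  fixes F :: "'i \<Rightarrow> real^'n^'m"
  shows "(\<Sum>i\<in>I. F i) *v x = (\<Sum>i\<in>I. F i *v x)"
  by (induction I rule: infinite_finite_induct) (auto simp: matrix_vector_mult_add_rdistrib)

lemma transpose_sum:
  fixes F :: "'i \<Rightarrow> real^'n^'m"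
  shows "transpose (\<Sum>i\<in>I. F i) = (\<Sum>i\<in>I. transpose (F i))"
  by (simp add: transpose_def vec_eq_iff)

definition spectral :: "(nat \<Rightarrow> real) \<Rightarrow> (nat \<Rightarrow> real^'n) \<Rightarrow> real^'n^'n" where
  "spectral l q = (\<Sum>i\<in>{1..CARD('n)}. l i *\<^sub>R outer (q i))"

lemma spectral_mult: "spectral l q *v x = (\<Sum>i\<in>{1..CARD('n)}. (l i * (q i \<bullet> x)) *\<^sub>R q i)"
  for q :: "nat \<Rightarrow> real^'n"
  by (simp add: spectral_def sum_matrix_vector_mult scaleR_matrix_vector_assoc[symmetric] outer_mult)

lemma spectral_inner: "x \<bullet> (spectral l q *v x) = (\<Sum>i\<in>{1..CARD('n)}. l i * (q i \<bullet> x)\<^sup>2)"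
  for q :: "nat \<Rightarrow> real^'n"
  by (simp add: spectral_mult inner_sum_right inner_commute power2_eq_square mult.assoc)

lemma transpose_spectral: "transpose (spectral l q) = spectral l q"
  by (simp add: spectral_def transpose_sum transpose_scalar transpose_outer)

lemma eigenbasis_spectral:
  assumes "orthonormal q {1..CARD('n)}"
  shows "eigenbasis (spectral l q) l (q :: nat \<Rightarrow> real^'n)"
proof -
  have "spectral l q *v q i = l i *\<^sub>R q i" if "i \<in> {1..CARD('n)}" for i
  proof -
    have "spectral l q *v q i = (\<Sum>j\<in>{1..CARD('n)}. if j = i then l i *\<^sub>R q i else 0)"
      unfolding spectral_mult using assms that by (intro sum.cong) (auto simp: orthonormal_def)
    then show ?thesis using that by simp
  qed
  then show ?thesis using assms by (simp add: eigenbasis_def)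
qed

lemma eigenbasis_eq_spectral:
  fixes X :: "real^'n^'n"
  assumes "eigenbasis X l q"
  shows "X = spectral l q"
proof -
  have on: "orthonormal q {1..CARD('n)}" using assms by (simp add: eigenbasis_def)
  have "X *v x = spectral l q *v x" for x
  proof -
    have "X *v x = X *v (\<Sum>i\<in>{1..CARD('n)}. (q i \<bullet> x) *\<^sub>R q i)"
      using orthonormal_sum_outer[OF on, of x] by simp
    also have "\<dots> = (\<Sum>i\<in>{1..CARD('n)}. (q i \<bullet> x) *\<^sub>R (X *v q i))"
      by (simp add: linear_sum[OF matrix_vector_mul_linear] matrix_vector_mult_scaleR)
    also have "\<dots> = spectral l q *v x"
      unfolding spectral_mult using assms by (intro sum.cong) (auto simp: eigenbasis_def mult.commute)
    finally show ?thesis .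
  qed
  then show ?thesis by (simp add: matrix_eq)
qed

lemma psd_spectral:
  fixes q :: "nat \<Rightarrow> real^'n"
  assumes "\<And>i. i \<in> {1..CARD('n)} \<Longrightarrow> 0 \<le> l i"
  shows "psd (spectral l q)"
  using assms by (auto simp: psd_def transpose_spectral spectral_inner intro!: sum_nonneg)

lemma pd_spectral:
  fixes q :: "nat \<Rightarrow> real^'n"
  assumes on: "orthonormal q {1..CARD('n)}" and l: "\<And>i. i \<in> {1..CARD('n)} \<Longrightarrow> 0 < l i"
  shows "pd (spectral l q)"
proof -
  have "0 < x \<bullet> (spectral l q *v x)" if "x \<noteq> 0" for x
  proof -
    have "\<exists>i\<in>{1..CARD('n)}. q i \<bullet> x \<noteq> 0"
      using orthonormal_sum_outer[OF on, of x] that by (metis (no_types, lifting) scale_eq_0_iff sum.neutral)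
    then obtain i where "i \<in> {1..CARD('n)}" "0 < l i * (q i \<bullet> x)\<^sup>2" using l by auto
    moreover have "0 \<le> l j * (q j \<bullet> x)\<^sup>2" if "j \<in> {1..CARD('n)}" for j
      using l[OF that] by simp
    ultimately show ?thesis unfolding spectral_inner by (intro sum_pos2) auto
  qed
  then show ?thesis by (simp add: pd_def transpose_spectral)
qed

lemma pd_imp_psd: "pd X \<Longrightarrow> psd X"
  unfolding pd_def psd_def by (metis inner_zero_left less_eq_real_def)

lemma orthonormal_ne_zero: "orthonormal q I \<Longrightarrow> i \<in> I \<Longrightarrow> q i \<noteq> 0"
  unfolding orthonormal_def by fastforce

lemma eigenbasis_Rayleigh:
  fixes X :: "real^'n^'n"
  assumes "eigenbasis X l q" "i \<in> {1..CARD('n)}"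
  shows "q i \<bullet> (X *v q i) = l i"
  using assms by (auto simp: eigenbasis_def orthonormal_def)

lemma psd_eig_nonneg:
  fixes X :: "real^'n^'n"
  assumes "psd X" "i \<in> {1..CARD('n)}"
  shows "0 \<le> eig X i"
proof -
  obtain q where "eigenbasis X (eig X) q" using assms(1) eig_sorted[of X] by (metis psd_def)
  then show ?thesis using eigenbasis_Rayleigh[of X "eig X" q i] assms by (metis psd_def)
qed

lemma pd_eig_pos:
  fixes X :: "real^'n^'n"
  assumes "pd X" "i \<in> {1..CARD('n)}"
  shows "0 < eig X i"
proof -
  obtain q where q: "eigenbasis X (eig X) q" using assms(1) eig_sorted[of X] by (metis pd_def)
  then have "q i \<noteq> 0" using orthonormal_ne_zero assms(2) unfolding eigenbasis_def by blast
  then show ?thesis using eigenbasis_Rayleigh[OF q assms(2)] assms(1) by (metis pd_def)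
qed

section \<open>The spectral function\<close>

text \<open>With denominators cleared the lower condition at \<open>k\<close> is \<open>P k\<close>.
  Removing one copy of the eigenvalue \<open>k + 1\<close> from both sides shows that the strict
  condition at \<open>k + 1\<close> is exactly the failure of \<open>P k\<close>. Since
  \<open>P\<close> is inherited by larger \<open>k\<close> below \<open>r\<close>, a split index
  must be the least \<open>k\<close> with \<open>P k\<close>. It exists because
  \<open>P (r - 1)\<close> only says that the eigenvalues beyond \<open>r\<close> have a nonnegative
  sum.\<close>

lemma split_index_properties:
  fixes X :: "real^'n^'n"
  assumes "psd X" "0 < r" "r \<le> CARD('n)"
  defines "k \<equiv> split_index r X"
  shows "k < r \<and> (0 < k \<longrightarrow> tail_mean r X k < eig X k) \<and> eig X (k + 1) \<le> tail_mean r X k"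
proof -
  have srt: "eig X (Suc i) \<le> eig X i" if "1 \<le> i" "i < CARD('n)" for i
    using eig_sorted[of X] assms(1) that by (metis Suc_leI le_add2 plus_1_eq_Suc psd_def)
  define T where "T k = (\<Sum>i = k + 1..CARD('n). eig X i)" for k
  have T: "T k = eig X (Suc k) + T (Suc k)" if "k < CARD('n)" for k
    unfolding T_def using that by (simp add: sum.atLeast_Suc_atMost)
  define P where "P k \<longleftrightarrow> real (r - k) * eig X (Suc k) \<le> T k" for k
  have P: "P k \<longleftrightarrow> eig X (k + 1) \<le> tail_mean r X k" if "k < r" for k
    using that by (simp add: P_def T_def tail_mean_def field_simps)
  have notP: "\<not> P k \<longleftrightarrow> tail_mean r X (Suc k) < eig X (Suc k)" if "Suc k < r" for k
    using that T[of k] assms(3) by (simp add: P_def T_def tail_mean_def field_simps of_nat_diff not_le)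
  have step: "P (Suc k)" if "P k" "Suc k < r" for k
  proof -
    have "real (r - Suc k) * eig X (Suc k) \<le> T (Suc k)"
      using that T[of k] assms(3) by (simp add: P_def algebra_simps of_nat_diff)
    moreover have "real (r - Suc k) * eig X (Suc (Suc k)) \<le> real (r - Suc k) * eig X (Suc k)"
      using srt[of "Suc k"] that assms(3) by (intro mult_left_mono) auto
    ultimately show ?thesis by (simp add: P_def)
  qed
  have mono: "P k'" if "P k" "k \<le> k'" "k' < r" for k k'
    using that(2,3,1) by (induction rule: dec_induct) (auto intro: step)
  have last: "P (r - 1)"
  proof -
    have "0 \<le> T r" unfolding T_def using psd_eig_nonneg[OF assms(1)] by (intro sum_nonneg) auto
    then show ?thesis using T[of "r - 1"] assms by (simp add: P_def)
  qed
  define k0 where "k0 = (LEAST k. P k)"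
  have k0: "P k0" and min: "\<And>k. k < k0 \<Longrightarrow> \<not> P k" and "k0 \<le> r - 1"
    unfolding k0_def using last by (auto intro: LeastI Least_le dest: not_less_Least)
  have "k0 < r" using \<open>k0 \<le> r - 1\<close> assms(2) by simp
  let ?S = "\<lambda>k. k < r \<and> (0 < k \<longrightarrow> tail_mean r X k < eig X k) \<and> eig X (k + 1) \<le> tail_mean r X k"
  have S: "?S k \<longleftrightarrow> k < r \<and> (0 < k \<longrightarrow> \<not> P (k - 1)) \<and> P k" for k
    using P[of k] notP[of "k - 1"] by (cases k) auto
  have "?S k0" using k0 min \<open>k0 < r\<close> by (subst S) auto
  moreover have "k = k0" if "?S k" for k
  proof (rule antisym)
    show "k0 \<le> k" using that min[of k] S[of k] by fastforce
    show "k \<le> k0"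
    proof (rule ccontr)
      assume "\<not> k \<le> k0"
      then have "P (k - 1)" using that mono[OF k0, of "k - 1"] by auto
      then show False using that S[of k] \<open>\<not> k \<le> k0\<close> by auto
    qed
  qed
  ultimately have "\<exists>!k. ?S k" by blast
  then show ?thesis unfolding k_def split_index_def by (rule theI')
qed

text \<open>Presents the tail eigenvalues as numbers in \<open>[0, m]\<close> with total
  \<open>m * (r - k)\<close>, the shape that \<open>bathtub\<close> expects of its weights.\<close>

lemma f_spec_split:
  fixes X :: "real^'n^'n"
  assumes "psd X" "0 < r" "r \<le> CARD('n)"
  obtains k m where "k < r" "0 \<le> m" "(\<Sum>i\<in>{Suc k..CARD('n)}. eig X i) = m * real (r - k)"
    "\<And>i. i \<in> {1..k} \<Longrightarrow> m < eig X i" "\<And>i. i \<in> {Suc k..CARD('n)} \<Longrightarrow> eig X i \<le> m"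
    "f_spec r X = (\<Prod>i\<in>{1..k}. eig X i) * m ^ (r - k)"
proof -
  define k where "k = split_index r X"
  define m where "m = tail_mean r X k"
  have k: "k < r" "0 < k \<Longrightarrow> m < eig X k" "eig X (Suc k) \<le> m"
    using split_index_properties[OF assms] by (auto simp: k_def m_def)
  have srt: "eig X j \<le> eig X i" if "1 \<le> i" "i \<le> j" "j \<le> CARD('n)" for i j
    using eig_sorted[of X] assms(1) that by (metis psd_def)
  have "0 \<le> eig X (Suc k)" using psd_eig_nonneg[OF assms(1)] k(1) assms(3) by auto
  then have m0: "0 \<le> m" using k(3) by simp
  have s: "(\<Sum>i\<in>{Suc k..CARD('n)}. eig X i) = m * real (r - k)"
    using k(1) by (simp add: m_def tail_mean_def)
  have a: "m < eig X i" if "i \<in> {1..k}" for i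
    using k(1,2) srt[of i k] that assms(3) by fastforce
  have b: "eig X i \<le> m" if "i \<in> {Suc k..CARD('n)}" for i
    using k(3) srt[of "Suc k" i] that by fastforce
  have "f_spec r X = (\<Prod>i\<in>{1..k}. eig X i) * m ^ (r - k)"
    by (simp add: f_spec_def Let_def k_def m_def)
  then show ?thesis using that k(1) m0 s a b by blast
qed

text \<open>Without mass beyond \<open>r\<close>, the eigenvalues from \<open>k + 1\<close> to
  \<open>r\<close> are at most \<open>m\<close> and have mean \<open>m\<close>, so each equals
  \<open>m\<close> and the power of the mean is their product.\<close>

lemma f_spec_low_rank:
  fixes X :: "real^'n^'n"
  assumes "psd X" "0 < r" "r \<le> CARD('n)" and zero: "\<And>i. i \<in> {Suc r..CARD('n)} \<Longrightarrow> eig X i = 0"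
  shows "f_spec r X = (\<Prod>i\<in>{1..r}. eig X i)"
proof -
  obtain k m where k: "k < r" "(\<Sum>i\<in>{Suc k..CARD('n)}. eig X i) = m * real (r - k)"
    "\<And>i. i \<in> {Suc k..CARD('n)} \<Longrightarrow> eig X i \<le> m"
    "f_spec r X = (\<Prod>i\<in>{1..k}. eig X i) * m ^ (r - k)"
    using f_spec_split[OF assms(1-3)] by metis
  have "(\<Sum>i\<in>{Suc k..CARD('n)}. eig X i) = (\<Sum>i\<in>{Suc k..r}. eig X i)"
    using zero assms(3) by (intro sum.mono_neutral_right) auto
  then have "(\<Sum>i\<in>{Suc k..r}. m - eig X i) = 0" using k(1,2) by (simp add: sum_subtractf mult.commute)
  moreover have "0 \<le> m - eig X i" if "i \<in> {Suc k..r}" for i using k(3)[of i] that assms(3) by auto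
  ultimately have "m - eig X i = 0" if "i \<in> {Suc k..r}" for i
    using that sum_nonneg_eq_0_iff[of "{Suc k..r}" "\<lambda>i. m - eig X i"] by auto
  then have "(\<Prod>i\<in>{Suc k..r}. eig X i) = (\<Prod>i\<in>{Suc k..r}. m)" by (intro prod.cong) auto
  then have "(\<Prod>i\<in>{Suc k..r}. eig X i) = m ^ (r - k)" by simp
  moreover have "(\<Prod>i\<in>{1..r}. eig X i) = (\<Prod>i\<in>{1..k}. eig X i) * (\<Prod>i\<in>{Suc k..r}. eig X i)"
    using k(1) prod.ub_add_nat[of 1 k "eig X" "r - k"] by simp
  ultimately show ?thesis using k(4) by simp
qed

section \<open>Weak duality for the logarithm of the spectral function\<close>

lemma bathtub:
  fixes a w :: "'i \<Rightarrow> real"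
  assumes "finite I" "J \<subseteq> I" and w: "\<And>i. i \<in> I \<Longrightarrow> 0 \<le> w i" "\<And>i. i \<in> I \<Longrightarrow> w i \<le> m"
    and total: "sum w I = m * card J" and low: "\<And>i j. i \<in> J \<Longrightarrow> j \<in> I - J \<Longrightarrow> a i \<le> a j"
  shows "m * sum a J \<le> (\<Sum>i\<in>I. w i * a i)"
proof (cases "J = {}")
  case True
  then have "sum w I = 0" using total by simp
  then have "\<And>i. i \<in> I \<Longrightarrow> w i = 0" using sum_nonneg_eq_0_iff[OF \<open>finite I\<close>, of w] w(1) by simp
  then show ?thesis using True by simp
next
  case False
  have finJ: "finite J" using assms finite_subset by blast
  \<comment> \<open>The threshold: \<open>a - t\<close> is nonpositive on \<open>J\<close>, where
    the weights may only be raised to \<open>m\<close>, and nonnegative off \<open>J\<close>, where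
    they may only be lowered to 0. The multiples of \<open>t\<close> cancel because the totals
    agree.\<close>
  define t where "t = Max (a ` J)"
  have t: "\<And>i. i \<in> J \<Longrightarrow> a i \<le> t" using finJ by (simp add: t_def)
  have "t \<in> a ` J" unfolding t_def using finJ False by (intro Max_in) auto
  then have t': "\<And>j. j \<in> I - J \<Longrightarrow> t \<le> a j" using low by auto
  have "m * (\<Sum>i\<in>J. a i - t) = (\<Sum>i\<in>J. m * (a i - t))" by (rule sum_distrib_left)
  also have "\<dots> \<le> (\<Sum>i\<in>J. w i * (a i - t))"
    using t w(2) assms(2) by (intro sum_mono mult_right_mono_neg) auto
  also have "\<dots> \<le> (\<Sum>i\<in>I. w i * (a i - t))"
    using t' w(1) assms(1,2) by (intro sum_mono2) auto
  also have "\<dots> = (\<Sum>i\<in>I. w i * a i) - t * sum w I"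
    by (simp add: right_diff_distrib sum_subtractf sum_distrib_left mult.commute)
  finally show ?thesis using total by (simp add: sum_subtractf algebra_simps)
qed

lemma least_subset_exists:
  fixes a :: "'i \<Rightarrow> real"
  assumes "finite I"
  shows "r \<le> card I \<Longrightarrow> \<exists>J\<subseteq>I. card J = r \<and> (\<forall>i\<in>J. \<forall>j\<in>I - J. a i \<le> a j)"
proof (induction r)
  case (Suc r)
  then obtain J where J: "J \<subseteq> I" "card J = r" "\<And>i j. i \<in> J \<Longrightarrow> j \<in> I - J \<Longrightarrow> a i \<le> a j" by auto
  have fin: "finite (I - J)" "finite J" using assms J(1) finite_subset by auto
  moreover have "I - J \<noteq> {}" using Suc.prems J(1,2) by (metis Diff_eq_empty_iff card_mono fin(2) not_less_eq_eq)
  ultimately obtain j where j: "j \<in> I - J" "\<And>i. i \<in> I - J \<Longrightarrow> a j \<le> a i"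
    using arg_min_if_finite(1)[of "I - J" a] arg_min_least[of "I - J" _ a] by metis
  have "card (insert j J) = Suc r" using j(1) J(2) fin by simp
  then show ?case using J j by (intro exI[of _ "insert j J"]) auto
qed auto

text \<open>The squared inner products of two orthonormal bases form a doubly stochastic matrix.
  Concavity of \<open>ln\<close> bounds each summand on the right from below by a weighted mean of
  the \<open>ln (eig L i)\<close>. Summed over \<open>J\<close>, the weights lie in
  \<open>[0, 1]\<close> with total \<open>card J\<close>, so concentrating them on the least
  eigenvalues can only decrease the sum.\<close>

lemma ln_det_least_le:
  fixes L :: "real^'n^'n"
  assumes L: "pd L" and on: "orthonormal q {1..CARD('n)}" and J: "J \<subseteq> {1..CARD('n)}"
  shows "ln (det_least (card J) L) \<le> (\<Sum>j\<in>J. ln (q j \<bullet> (L *v q j)))"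
proof -
  let ?n = "CARD('n)"
  define r where "r = card J"
  have "r \<le> ?n" unfolding r_def using card_mono[OF _ J] by simp
  have finJ: "finite J" using J finite_subset by blast
  obtain p where p: "eigenbasis L (eig L) p" and srt: "\<And>i j. 1 \<le> i \<Longrightarrow> i \<le> j \<Longrightarrow> j \<le> ?n \<Longrightarrow> eig L j \<le> eig L i"
    using eig_sorted[of L] L by (metis pd_def)
  have onp: "orthonormal p {1..?n}" using p by (simp add: eigenbasis_def)
  define w where "w j i = (p i \<bullet> q j)\<^sup>2" for j i
  have pos: "0 < eig L i" if "i \<in> {1..?n}" for i using pd_eig_pos[OF L that] .
  have wsum: "(\<Sum>i\<in>{1..?n}. w j i) = 1" if "j \<in> {1..?n}" for j
    using orthonormal_inner[OF onp, of "q j" "q j"] on that by (simp add: w_def power2_eq_square orthonormal_def)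
  have wsum': "(\<Sum>j\<in>{1..?n}. w j i) = 1" if "i \<in> {1..?n}" for i
    using orthonormal_inner[OF on, of "p i" "p i"] onp that
    by (simp add: w_def power2_eq_square orthonormal_def inner_commute)
  have form: "q j \<bullet> (L *v q j) = (\<Sum>i\<in>{1..?n}. w j i * eig L i)" for j
    using spectral_inner[of "q j" "eig L" p] eigenbasis_eq_spectral[OF p] by (simp add: w_def mult.commute)
  have Jensen: "(\<Sum>i\<in>{1..?n}. w j i * ln (eig L i)) \<le> ln (q j \<bullet> (L *v q j))" if j: "j \<in> {1..?n}" for j
  proof -
    define b where "b = q j \<bullet> (L *v q j)"
    have "q j \<noteq> 0" using orthonormal_ne_zero[OF on j] .
    then have "0 < b" using L by (simp add: b_def pd_def)
    \<comment> \<open>The tangent to \<open>ln\<close> at the mean \<open>b\<close>. After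
      averaging, the linear terms cancel because the weights sum to 1.\<close>
    have "ln (eig L i) \<le> ln b + (eig L i / b - 1)" if "i \<in> {1..?n}" for i
      using ln_le_minus_one[of "eig L i / b"] pos[OF that] \<open>0 < b\<close> by (simp add: ln_div)
    then have "(\<Sum>i\<in>{1..?n}. w j i * ln (eig L i)) \<le> (\<Sum>i\<in>{1..?n}. w j i * (ln b + (eig L i / b - 1)))"
      by (intro sum_mono mult_left_mono) (auto simp: w_def)
    also have "\<dots> = (ln b - 1) * (\<Sum>i\<in>{1..?n}. w j i) + (\<Sum>i\<in>{1..?n}. w j i * eig L i) / b"
      by (simp add: algebra_simps sum.distrib sum_subtractf sum_distrib_left sum_divide_distrib)
    also have "\<dots> = ln b" using wsum[OF j] form[of j] \<open>0 < b\<close> by (simp add: b_def)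
    finally show ?thesis by (simp add: b_def)
  qed
  define W where "W i = (\<Sum>j\<in>J. w j i)" for i
  have "1 * (\<Sum>i\<in>{?n - r + 1..?n}. ln (eig L i)) \<le> (\<Sum>i\<in>{1..?n}. W i * ln (eig L i))"
  proof (rule bathtub)
    show "{?n - r + 1..?n} \<subseteq> {1..?n}" by auto
    show "0 \<le> W i" for i by (auto simp: W_def w_def intro: sum_nonneg)
    show "W i \<le> 1" if "i \<in> {1..?n}" for i
      unfolding W_def wsum'[OF that, symmetric] using J by (intro sum_mono2) (auto simp: w_def)
    have "sum W {1..?n} = (\<Sum>j\<in>J. \<Sum>i\<in>{1..?n}. w j i)" unfolding W_def by (rule sum.swap)
    also have "\<dots> = (\<Sum>j\<in>J. 1)" using wsum J by (intro sum.cong) auto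
    finally show "sum W {1..?n} = 1 * real (card {?n - r + 1..?n})" using \<open>r \<le> ?n\<close> by (simp add: r_def)
    show "ln (eig L i) \<le> ln (eig L j)" if "i \<in> {?n - r + 1..?n}" "j \<in> {1..?n} - {?n - r + 1..?n}" for i j
      using that pos[of i] pos[of j] srt[of j i] by auto
  qed simp
  also have "(\<Sum>i\<in>{1..?n}. W i * ln (eig L i)) = (\<Sum>j\<in>J. \<Sum>i\<in>{1..?n}. w j i * ln (eig L i))"
    unfolding W_def sum_distrib_right by (rule sum.swap)
  also have "\<dots> \<le> (\<Sum>j\<in>J. ln (q j \<bullet> (L *v q j)))" using Jensen J by (intro sum_mono) auto
  also have "(\<Sum>i\<in>{?n - r + 1..?n}. ln (eig L i)) = ln (det_least r L)"
  proof -
    have "eig L i \<noteq> 0" if "i \<in> {?n - r + 1..?n}" for i using pos[of i] that by auto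
    then show ?thesis unfolding det_least_def by (subst ln_prod) auto
  qed
  finally show ?thesis by (simp add: r_def)
qed

lemma trace_mult_eigenbasis:
  fixes X L :: "real^'n^'n"
  assumes "eigenbasis X l q"
  shows "trace (L ** X) = (\<Sum>i\<in>{1..CARD('n)}. l i * (q i \<bullet> (L *v q i)))"
proof -
  have "trace (L ** X) = (\<Sum>i\<in>{1..CARD('n)}. q i \<bullet> ((L ** X) *v q i))"
    using assms by (intro trace_orthonormal) (simp add: eigenbasis_def)
  also have "\<dots> = (\<Sum>i\<in>{1..CARD('n)}. l i * (q i \<bullet> (L *v q i)))"
    using assms by (intro sum.cong)
      (auto simp: eigenbasis_def matrix_vector_mul_assoc[symmetric] matrix_vector_mult_scaleR)
  finally show ?thesis .
qed

lemma ln_f_spec_le: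
  fixes X L :: "real^'n^'n"
  assumes X: "psd X" and r: "0 < r" "r \<le> CARD('n)" and f: "0 < f_spec r X" and L: "pd L"
  shows "ln (f_spec r X) \<le> trace (L ** X) - ln (det_least r L) - real r"
proof -
  let ?n = "CARD('n)"
  obtain k m where k: "k < r" "0 \<le> m" "(\<Sum>i\<in>{Suc k..?n}. eig X i) = m * real (r - k)"
    "\<And>i. i \<in> {1..k} \<Longrightarrow> m < eig X i" "\<And>i. i \<in> {Suc k..?n} \<Longrightarrow> eig X i \<le> m"
    "f_spec r X = (\<Prod>i\<in>{1..k}. eig X i) * m ^ (r - k)"
    using f_spec_split[OF X r] by metis
  have "m \<noteq> 0" using f k(1) by (auto simp: k(6) power_0_left)
  then have m: "0 < m" using k(2) by simp
  have l: "0 < eig X i" if "i \<in> {1..k}" for i using k(4)[OF that] m by simp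
  obtain q where q: "eigenbasis X (eig X) q" using eig_sorted[of X] X by (metis psd_def)
  have on: "orthonormal q {1..?n}" using q by (simp add: eigenbasis_def)
  define a where "a i = q i \<bullet> (L *v q i)" for i
  have a: "0 < a i" if "i \<in> {1..?n}" for i
    using L orthonormal_ne_zero[OF on that] by (simp add: a_def pd_def)
  obtain J where J: "J \<subseteq> {Suc k..?n}" "card J = r - k" "\<And>i j. i \<in> J \<Longrightarrow> j \<in> {Suc k..?n} - J \<Longrightarrow> a i \<le> a j"
    using least_subset_exists[of "{Suc k..?n}" "r - k" a] r by fastforce
  have finJ: "finite J" using J(1) finite_subset by blast
  have disj: "{1..k} \<inter> J = {}" using J(1) by auto
  have "card ({1..k} \<union> J) = r" using J(2) k(1) disj finJ by (subst card_Un_disjoint) auto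
  then have "ln (det_least r L) \<le> (\<Sum>j\<in>{1..k} \<union> J. ln (a j))"
    unfolding a_def using ln_det_least_le[OF L on, of "{1..k} \<union> J"] J(1) k(1) r by fastforce
  also have "\<dots> = (\<Sum>j\<in>{1..k}. ln (a j)) + (\<Sum>j\<in>J. ln (a j))"
    using disj finJ by (intro sum.union_disjoint) auto
  finally have 1: "ln (det_least r L) \<le> (\<Sum>j\<in>{1..k}. ln (a j)) + (\<Sum>j\<in>J. ln (a j))" .
  have 2: "ln (f_spec r X) = (\<Sum>i\<in>{1..k}. ln (eig X i)) + real (r - k) * ln m"
  proof -
    have "0 < (\<Prod>i\<in>{1..k}. eig X i)" using l by (intro prod_pos) auto
    moreover have "ln (\<Prod>i\<in>{1..k}. eig X i) = (\<Sum>i\<in>{1..k}. ln (eig X i))"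
      by (rule ln_prod) (use l in fastforce)+
    moreover have "ln ((\<Prod>i\<in>{1..k}. eig X i) * m ^ (r - k)) = ln (\<Prod>i\<in>{1..k}. eig X i) + ln (m ^ (r - k))"
      using m \<open>0 < (\<Prod>i\<in>{1..k}. eig X i)\<close> by (intro ln_mult_pos) auto
    ultimately show ?thesis using m by (simp only: k(6) ln_realpow)
  qed
  have "(\<Sum>i\<in>{1..k}. ln (eig X i) + ln (a i)) \<le> (\<Sum>i\<in>{1..k}. eig X i * a i - 1)"
  proof (rule sum_mono)
    fix i assume i: "i \<in> {1..k}"
    then have "0 < a i" using a k(1) r by auto
    then show "ln (eig X i) + ln (a i) \<le> eig X i * a i - 1"
      using ln_le_minus_one[of "eig X i * a i"] l[OF i] by (simp add: ln_mult)
  qed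
  then have 3: "(\<Sum>i\<in>{1..k}. ln (eig X i)) + (\<Sum>i\<in>{1..k}. ln (a i)) \<le> (\<Sum>i\<in>{1..k}. eig X i * a i) - real k"
    by (simp add: sum.distrib sum_subtractf)
  have "(\<Sum>i\<in>J. ln m + ln (a i)) \<le> (\<Sum>i\<in>J. m * a i - 1)"
  proof (rule sum_mono)
    fix i assume i: "i \<in> J"
    then have "0 < a i" using a J(1) by auto
    then show "ln m + ln (a i) \<le> m * a i - 1"
      using ln_le_minus_one[of "m * a i"] m by (simp add: ln_mult)
  qed
  then have 4: "real (r - k) * ln m + (\<Sum>i\<in>J. ln (a i)) \<le> m * sum a J - real (r - k)"
    using J(2) by (simp add: sum.distrib sum_subtractf sum_distrib_left)
  \<comment> \<open>The tail of the trace does not increase when the tail eigenvalues are replaced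
    by \<open>m\<close> on \<open>J\<close> and 0 elsewhere, since \<open>J\<close> carries the
    least \<open>a i\<close>.\<close>
  have 5: "m * sum a J \<le> (\<Sum>i\<in>{Suc k..?n}. eig X i * a i)"
  proof (rule bathtub)
    show "0 \<le> eig X i" if "i \<in> {Suc k..?n}" for i using psd_eig_nonneg[OF X] that by auto
  qed (use J k in auto)
  have "trace (L ** X) = (\<Sum>i\<in>{1..?n}. eig X i * a i)"
    unfolding a_def by (rule trace_mult_eigenbasis[OF q])
  also have "\<dots> = (\<Sum>i\<in>{1..k}. eig X i * a i) + (\<Sum>i\<in>{Suc k..?n}. eig X i * a i)"
    using k(1) r(2) sum.ub_add_nat[of 1 k "\<lambda>i. eig X i * a i" "?n - k"] by simp
  finally show ?thesis using 1 2 3 4 5 k(1) by (simp add: of_nat_diff)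
qed

section \<open>Equality in weak duality, and monotonicity\<close>

lemma orthonormal_rev:
  "orthonormal q {1..m} \<Longrightarrow> orthonormal (\<lambda>i. q (m + 1 - i)) {1..m}"
  unfolding orthonormal_def
proof (intro ballI)
  fix i j assume q: "\<forall>i\<in>{1..m}. \<forall>j\<in>{1..m}. q i \<bullet> q j = (if i = j then 1 else 0)"
    and ij: "i \<in> {1..m}" "j \<in> {1..m}"
  then have "m + 1 - i \<in> {1..m}" "m + 1 - j \<in> {1..m}" "m + 1 - i = m + 1 - j \<longleftrightarrow> i = j" by auto
  then show "q (m + 1 - i) \<bullet> q (m + 1 - j) = (if i = j then 1 else 0)" using q by simp
qed

lemma spectral_rev:
  fixes q :: "nat \<Rightarrow> real^'n"
  shows "spectral (\<lambda>i. l (CARD('n) + 1 - i)) (\<lambda>i. q (CARD('n) + 1 - i)) = spectral l q"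
  unfolding spectral_def
  by (subst (2) sum.atLeastAtMost_rev) simp

text \<open>\<open>eig\<close> lists eigenvalues in decreasing order. Reversing an increasing
  spectrum turns the last \<open>r\<close> positions into the first \<open>r\<close>.\<close>

lemma det_least_spectral:
  fixes q :: "nat \<Rightarrow> real^'n"
  assumes on: "orthonormal q {1..CARD('n)}" and "r \<le> CARD('n)"
    and mono: "\<And>i j. 1 \<le> i \<Longrightarrow> i \<le> j \<Longrightarrow> j \<le> CARD('n) \<Longrightarrow> l i \<le> l j"
  shows "det_least r (spectral l q) = (\<Prod>i\<in>{1..r}. l i)"
proof -
  let ?n = "CARD('n)"
  have eb: "eigenbasis (spectral l q) (\<lambda>i. l (?n + 1 - i)) (\<lambda>i. q (?n + 1 - i))"
    using eigenbasis_spectral[OF orthonormal_rev[OF on], of "\<lambda>i. l (?n + 1 - i)"]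
    by (simp only: spectral_rev)
  have "eig (spectral l q) i = l (?n + 1 - i)" if "i \<in> {1..?n}" for i
    by (rule eig_eqI[OF eb _ that]) (use mono in auto)
  then have "det_least r (spectral l q) = (\<Prod>i\<in>{?n - r + 1..?n}. l (?n + 1 - i))"
    unfolding det_least_def by (intro prod.cong) auto
  also have "\<dots> = (\<Prod>i\<in>{1..r}. l i)"
    by (rule prod.reindex_bij_witness[of _ "\<lambda>i. ?n + 1 - i" "\<lambda>i. ?n + 1 - i"]) (use assms(2) in auto)
  finally show ?thesis .
qed

text \<open>\<open>L\<close> shares the eigenvectors of \<open>Y\<close>, with eigenvalues
  \<open>1 / eig Y i\<close> up to the split index and \<open>1 / h\<close> beyond it. For
  \<open>m > 0\<close> the choice \<open>h = m\<close> gives the value \<open>log_f r Y\<close>. For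
  \<open>m = 0\<close> the tail of \<open>Y\<close> vanishes, \<open>log_f\<close> is minus
  infinity, and a small \<open>h\<close> pushes the value below any \<open>K\<close>; no
  \<open>L\<close> attains the infimum, hence the strict bound by \<open>K\<close>.\<close>

lemma log_f_dual_approx:
  fixes Y :: "real^'n^'n"
  assumes Y: "psd Y" and r: "0 < r" "r \<le> CARD('n)" and K: "log_f r Y < ereal K"
  shows "\<exists>L. pd L \<and> trace (L ** Y) - ln (det_least r L) - real r < K"
proof -
  let ?n = "CARD('n)"
  obtain k m where k: "k < r" "0 \<le> m" "(\<Sum>i\<in>{Suc k..?n}. eig Y i) = m * real (r - k)"
    "\<And>i. i \<in> {1..k} \<Longrightarrow> m < eig Y i" "f_spec r Y = (\<Prod>i\<in>{1..k}. eig Y i) * m ^ (r - k)"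
    using f_spec_split[OF Y r] by metis
  have l: "0 < eig Y i" if "i \<in> {1..k}" for i using k(4)[OF that] k(2) by simp
  define s where "s = (\<Sum>i\<in>{1..k}. ln (eig Y i))"
  have lnprod: "ln (\<Prod>i\<in>{1..k}. eig Y i) = s" unfolding s_def by (rule ln_prod) (use l in fastforce)+
  have prodpos: "0 < (\<Prod>i\<in>{1..k}. eig Y i)" using l by (intro prod_pos) auto
  obtain h where h: "0 < h" "\<And>i. i \<in> {1..k} \<Longrightarrow> h \<le> eig Y i"
    "(\<Sum>i\<in>{Suc k..?n}. eig Y i) / h \<le> real (r - k)" "s + real (r - k) * ln h < K"
  proof (cases "m = 0")
    case False
    then have m: "0 < m" using k(2) by simp
    then have f: "0 < f_spec r Y" using prodpos by (simp add: k(5))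
    have "ln (f_spec r Y) = s + real (r - k) * ln m"
      using ln_mult_pos[OF prodpos, of "m ^ (r - k)"] m lnprod by (simp only: k(5) ln_realpow zero_less_power)
    then have "s + real (r - k) * ln m < K" using K f by (simp add: log_f_def)
    moreover have "(\<Sum>i\<in>{Suc k..?n}. eig Y i) / m \<le> real (r - k)" using m by (simp add: k(3))
    ultimately show ?thesis using that[of m] m k(4) less_imp_le by blast
  next
    case True
    \<comment> \<open>Solves \<open>s + (r - k) * ln E = K - 1\<close>. The minimum with the leading
      eigenvalues keeps \<open>a\<close> below increasing, so that its first \<open>r\<close> values
      are the least.\<close>
    define E where "E = exp ((K - s - 1) / real (r - k))"
    define h where "h = Min (insert E (eig Y ` {1..k}))"
    have "0 < h" unfolding h_def using l by (subst Min_gr_iff) (auto simp: E_def)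
    moreover have "h \<le> E" and hl: "\<And>i. i \<in> {1..k} \<Longrightarrow> h \<le> eig Y i"
      unfolding h_def by (auto intro!: Min_le simp del: Min_insert)
    ultimately have "ln h \<le> ln E" by simp
    then have "real (r - k) * ln h \<le> real (r - k) * ((K - s - 1) / real (r - k))"
      by (intro mult_left_mono) (auto simp: E_def)
    then have "s + real (r - k) * ln h < K" using k(1) by simp
    then show ?thesis using that[of h] \<open>0 < h\<close> hl k(3) True by simp
  qed
  obtain q where q: "eigenbasis Y (eig Y) q" and srt: "\<And>i j. 1 \<le> i \<Longrightarrow> i \<le> j \<Longrightarrow> j \<le> ?n \<Longrightarrow> eig Y j \<le> eig Y i"
    using eig_sorted[of Y] Y by (metis psd_def)
  have on: "orthonormal q {1..?n}" using q by (simp add: eigenbasis_def)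
  define a where "a i = (if i \<le> k then 1 / eig Y i else 1 / h)" for i
  have apos: "0 < a i" if "i \<in> {1..?n}" for i using that l h(1) by (auto simp: a_def)
  have mono: "a i \<le> a j" if "1 \<le> i" "i \<le> j" "j \<le> ?n" for i j
    using that l h(1) h(2)[of i] srt[of i j] by (auto simp: a_def intro!: divide_left_mono mult_pos_pos)
  define L where "L = spectral a q"
  have "pd L" unfolding L_def by (rule pd_spectral[OF on apos])
  have "det_least r L = (\<Prod>i\<in>{1..r}. a i)" unfolding L_def by (rule det_least_spectral[OF on r(2) mono])
  also have "ln \<dots> = (\<Sum>i\<in>{1..r}. ln (a i))"
  proof (rule ln_prod)
    show "a i \<noteq> 0" if "i \<in> {1..r}" for i using apos[of i] that r(2) by auto
  qed simp
  also have "\<dots> = (\<Sum>i\<in>{1..k}. ln (a i)) + (\<Sum>i\<in>{Suc k..r}. ln (a i))"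
    using k(1) sum.ub_add_nat[of 1 k "\<lambda>i. ln (a i)" "r - k"] by simp
  also have "(\<Sum>i\<in>{1..k}. ln (a i)) = - s"
    unfolding s_def sum_negf[symmetric] by (intro sum.cong) (use l in \<open>auto simp: a_def ln_div\<close>)
  also have "(\<Sum>i\<in>{Suc k..r}. ln (a i)) = (\<Sum>i\<in>{Suc k..r}. - ln h)"
    by (intro sum.cong) (use h(1) in \<open>auto simp: a_def ln_div\<close>)
  finally have det: "ln (det_least r L) = - s - real (r - k) * ln h" using k(1) by simp
  have "trace (L ** Y) = (\<Sum>i\<in>{1..?n}. eig Y i * a i)"
    unfolding trace_mult_eigenbasis[OF q] L_def
    by (intro sum.cong) (auto simp: eigenbasis_Rayleigh[OF eigenbasis_spectral[OF on]])
  also have "\<dots> = (\<Sum>i\<in>{1..k}. eig Y i * a i) + (\<Sum>i\<in>{Suc k..?n}. eig Y i * a i)"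
    using k(1) r(2) sum.ub_add_nat[of 1 k "\<lambda>i. eig Y i * a i" "?n - k"] by simp
  also have "(\<Sum>i\<in>{1..k}. eig Y i * a i) = (\<Sum>i\<in>{1..k}. 1)"
    by (intro sum.cong) (use l in \<open>fastforce simp: a_def\<close>)+
  also have "(\<Sum>i\<in>{Suc k..?n}. eig Y i * a i) = (\<Sum>i\<in>{Suc k..?n}. eig Y i) / h"
    unfolding sum_divide_distrib by (intro sum.cong) (auto simp: a_def)
  finally have "trace (L ** Y) \<le> real r" using h(3) k(1) by simp
  with h(4) have "trace (L ** Y) - ln (det_least r L) - real r < K" unfolding det by linarith
  with \<open>pd L\<close> show ?thesis by blast
qed

lemma trace_mult_nonneg:
  fixes L Z :: "real^'n^'n"
  assumes "psd L" "psd Z"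
  shows "0 \<le> trace (L ** Z)"
proof -
  obtain q where q: "eigenbasis Z (eig Z) q" using eig_sorted[of Z] assms(2) by (metis psd_def)
  show ?thesis unfolding trace_mult_eigenbasis[OF q]
    using assms psd_eig_nonneg[OF assms(2)] by (intro sum_nonneg mult_nonneg_nonneg) (auto simp: psd_def)
qed

lemma matrix_diff_ldistrib: "A ** (B - C) = A ** B - A ** (C :: real^'p^'n)"
  by (simp add: matrix_matrix_mult_def vec_eq_iff right_diff_distrib sum_subtractf)

lemma log_f_mono:
  fixes X Y :: "real^'n^'n"
  assumes "psd X" "psd Y" "psd (Y - X)" and r: "0 < r" "r \<le> CARD('n)"
  shows "log_f r X \<le> log_f r Y"
proof (rule ccontr)
  assume "\<not> log_f r X \<le> log_f r Y"
  then have less: "log_f r Y < log_f r X" by simp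
  then have f: "0 < f_spec r X" by (auto simp: log_f_def split: if_splits)
  then obtain L where L: "pd L" "trace (L ** Y) - ln (det_least r L) - real r < ln (f_spec r X)"
    using log_f_dual_approx[OF assms(2) r, of "ln (f_spec r X)"] less by (auto simp: log_f_def)
  moreover have "ln (f_spec r X) \<le> trace (L ** X) - ln (det_least r L) - real r"
    by (rule ln_f_spec_le[OF assms(1) r f L(1)])
  moreover have "trace (L ** X) \<le> trace (L ** Y)"
    using trace_mult_nonneg[OF pd_imp_psd[OF L(1)] assms(3)] by (simp add: matrix_diff_ldistrib trace_sub)
  ultimately show False by linarith
qed

text \<open>For \<open>e = 0\<close> the matrix \<open>X\<close> is the maximizer of \<open>log f\<^sub>r(X) - tr (L X)\<close>; letting \<open>e\<close> tend to 0 shows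
  that this difference is unbounded when \<open>L\<close> is singular.\<close>

lemma conjugate_witness:
  fixes L :: "real^'n^'n"
  assumes L: "psd L" and r: "0 < r" "r \<le> CARD('n)" and e: "0 \<le> e"
    and pos: "\<And>i. i \<in> {1..CARD('n)} \<Longrightarrow> 0 < eig L i + e"
  obtains X where "psd X" "0 < f_spec r X" "trace (L ** X) \<le> real r" "e = 0 \<Longrightarrow> trace (L ** X) = real r"
    "ln (f_spec r X) = - (\<Sum>i\<in>{CARD('n) - r + 1..CARD('n)}. ln (eig L i + e))"
proof -
  let ?n = "CARD('n)"
  obtain p where p: "eigenbasis L (eig L) p" and srt: "\<And>i j. 1 \<le> i \<Longrightarrow> i \<le> j \<Longrightarrow> j \<le> ?n \<Longrightarrow> eig L j \<le> eig L i"
    using eig_sorted[of L] L by (metis psd_def)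
  have onp: "orthonormal p {1..?n}" using p by (simp add: eigenbasis_def)
  define q where "q i = p (?n + 1 - i)" for i
  have on: "orthonormal q {1..?n}" using orthonormal_rev[OF onp] by (simp add: q_def[abs_def])
  define g where "g i = eig L (?n + 1 - i) + e" for i
  have g: "0 < g i" if "i \<in> {1..?n}" for i unfolding g_def using that by (intro pos) auto
  \<comment> \<open>\<open>g\<close> increases because of the reversal, so \<open>l\<close>
    decreases and lists the eigenvalues of \<open>X\<close> in the order of \<open>eig\<close>;
    cutting off after \<open>r\<close> makes \<open>f_spec_low_rank\<close> applicable.\<close>
  define l where "l i = (if i \<le> r then 1 / g i else 0)" for i
  have l0: "0 \<le> l i" if "i \<in> {1..?n}" for i using g[OF that] by (simp add: l_def)
  have lmono: "l j \<le> l i" if "1 \<le> i" "i \<le> j" "j \<le> ?n" for i j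
  proof -
    have "eig L (?n + 1 - i) \<le> eig L (?n + 1 - j)" using that by (intro srt) auto
    then have "g i \<le> g j" by (simp add: g_def)
    then show ?thesis using that g[of i] g[of j] by (auto simp: l_def intro!: divide_left_mono mult_pos_pos)
  qed
  define X where "X = spectral l q"
  have eb: "eigenbasis X l q" unfolding X_def by (rule eigenbasis_spectral[OF on])
  have X: "psd X" unfolding X_def by (rule psd_spectral[OF l0])
  have eX: "eig X i = l i" if "i \<in> {1..?n}" for i by (rule eig_eqI[OF eb lmono that])
  have "f_spec r X = (\<Prod>i\<in>{1..r}. eig X i)"
    by (rule f_spec_low_rank[OF X r]) (auto simp: eX l_def)
  also have "\<dots> = (\<Prod>i\<in>{1..r}. inverse (g i))"
    using r by (intro prod.cong) (auto simp: eX l_def divide_inverse)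
  also have "\<dots> = (\<Prod>i\<in>{?n - r + 1..?n}. inverse (eig L i + e))"
    by (rule prod.reindex_bij_witness[of _ "\<lambda>i. ?n + 1 - i" "\<lambda>i. ?n + 1 - i"])
      (use r in \<open>auto simp: g_def\<close>)
  finally have f: "f_spec r X = (\<Prod>i\<in>{?n - r + 1..?n}. inverse (eig L i + e))" .
  have pos': "0 < inverse (eig L i + e)" if "i \<in> {?n - r + 1..?n}" for i
    using that pos[of i] by auto
  have f0: "0 < f_spec r X" unfolding f by (intro prod_pos ballI pos')
  have "ln (f_spec r X) = (\<Sum>i\<in>{?n - r + 1..?n}. ln (inverse (eig L i + e)))"
    unfolding f by (rule ln_prod) (use pos' in fastforce)+
  then have lnf: "ln (f_spec r X) = - (\<Sum>i\<in>{?n - r + 1..?n}. ln (eig L i + e))"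
    by (simp add: ln_inverse sum_negf)
  have "trace (L ** X) = (\<Sum>i\<in>{1..?n}. l i * (q i \<bullet> (L *v q i)))"
    by (rule trace_mult_eigenbasis[OF eb])
  also have "\<dots> = (\<Sum>i\<in>{1..r}. l i * (q i \<bullet> (L *v q i)))"
    using r by (intro sum.mono_neutral_right) (auto simp: l_def)
  also have "\<dots> = (\<Sum>i\<in>{1..r}. eig L (?n + 1 - i) / g i)"
  proof (rule sum.cong[OF refl])
    fix i assume i: "i \<in> {1..r}"
    then have "?n + 1 - i \<in> {1..?n}" using r by auto
    then show "l i * (q i \<bullet> (L *v q i)) = eig L (?n + 1 - i) / g i"
      using i by (simp only: q_def eigenbasis_Rayleigh[OF p]) (simp add: l_def)
  qed
  finally have tr: "trace (L ** X) = (\<Sum>i\<in>{1..r}. eig L (?n + 1 - i) / g i)" .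
  have "trace (L ** X) \<le> (\<Sum>i\<in>{1..r}. 1)"
    unfolding tr using g e r by (intro sum_mono) (auto simp: g_def)
  moreover have "trace (L ** X) = (\<Sum>i\<in>{1..r}. 1)" if "e = 0"
    unfolding tr
  proof (rule sum.cong[OF refl])
    fix i assume "i \<in> {1..r}"
    then show "eig L (?n + 1 - i) / g i = 1" using g[of i] r that by (simp add: g_def)
  qed
  ultimately show ?thesis using that[OF X f0] lnf by simp
qed

lemma conjugate_attained:
  fixes L :: "real^'n^'n"
  assumes L: "pd L" and r: "0 < r" "r \<le> CARD('n)"
  obtains X where "psd X" "0 < f_spec r X" "trace (L ** X) = real r" "ln (f_spec r X) = - ln (det_least r L)"
proof -
  have e: "0 < eig L i" if "i \<in> {1..CARD('n)}" for i by (rule pd_eig_pos[OF L that])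
  have "ln (det_least r L) = (\<Sum>i\<in>{CARD('n) - r + 1..CARD('n)}. ln (eig L i + 0))"
  proof -
    have "eig L i \<noteq> 0" if "i \<in> {CARD('n) - r + 1..CARD('n)}" for i using e[of i] that by auto
    then show ?thesis unfolding det_least_def by (subst ln_prod) auto
  qed
  then show ?thesis using conjugate_witness[OF pd_imp_psd[OF L] r, of 0] e that by auto
qed

section \<open>The Lagrangian dual\<close>

lemma trace_mult_outer: "trace (L ** outer v) = v \<bullet> (L *v v)"
proof -
  have "trace (L ** outer v) = trace ((L ** columnvector v) ** (rowvector v :: real^_^1))"
    by (simp add: outer_def matrix_mul_assoc)
  also have "\<dots> = v \<bullet> (L *v v)"
    unfolding dot_rowvector_columnvector[symmetric]
    by (simp add: trace_def matrix_matrix_mult_def columnvector_def rowvector_def inner_vec_def mult.commute)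
  finally show ?thesis .
qed

lemma matrix_sum_ldistrib: "A ** (\<Sum>i\<in>I. F i) = (\<Sum>i\<in>I. A ** (F i :: real^'p^'n))"
  by (induction I rule: infinite_finite_induct) (auto simp: matrix_add_ldistrib)

lemma trace_sum: "trace (\<Sum>i\<in>I. F i) = (\<Sum>i\<in>I. trace (F i :: real^'n^'n))"
  by (induction I rule: infinite_finite_induct) (auto simp: trace_def sum.distrib)

lemma trace_scaleR: "trace (c *\<^sub>R X) = c * trace (X :: real^'n^'n)"
  by (simp add: trace_def sum_distrib_left)

lemma trace_mult_weighted_outer:
  "trace (L ** weighted_outer U x) = (\<Sum>i\<in>UNIV. x $ i * (column i U \<bullet> (L *v column i U)))"
  by (simp add: weighted_outer_def matrix_sum_ldistrib trace_sum matrix_scalar_ac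
      scalar_matrix_assoc[symmetric] trace_scaleR trace_mult_outer)

lemma weighted_outer_inner:
  "y \<bullet> (weighted_outer U x *v y) = (\<Sum>i\<in>UNIV. x $ i * (column i U \<bullet> y)\<^sup>2)"
  by (simp add: weighted_outer_def sum_matrix_vector_mult scaleR_matrix_vector_assoc[symmetric]
      outer_mult inner_sum_right inner_commute power2_eq_square mult.assoc)

lemma transpose_weighted_outer: "transpose (weighted_outer U x) = weighted_outer U x"
  by (simp add: weighted_outer_def transpose_sum transpose_scalar transpose_outer)

lemma psd_weighted_outer: "(\<And>i. 0 \<le> x $ i) \<Longrightarrow> psd (weighted_outer U x)"
  by (simp add: psd_def transpose_weighted_outer weighted_outer_inner sum_nonneg)

lemma psd_0: "psd 0"
  by (simp add: psd_def transpose_def vec_eq_iff)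

text \<open>Since \<open>log_f\<close> is monotone, the best \<open>X\<close> below the weighted sum
  is the weighted sum itself.\<close>

lemma relaxation_eq_lifted:
  fixes U :: "real^'n^'n"
  assumes r: "0 < r" "r \<le> CARD('n)"
  shows "relaxation c r U = lifted_relaxation c r U"
proof (rule antisym)
  have p: "psd (weighted_outer U x)" if "x \<in> relaxed_set r" for x
    using that by (intro psd_weighted_outer) (simp add: relaxed_set_def)
  show "relaxation c r U \<le> lifted_relaxation c r U"
    unfolding relaxation_def lifted_relaxation_def
  proof (rule SUP_least)
    fix x :: "real^'n" assume x: "x \<in> relaxed_set r"
    show "ereal c + log_f r (weighted_outer U x) \<le>
      (SUP (x, X)\<in>{(x, X). x \<in> relaxed_set r \<and> psd X \<and> psd (weighted_outer U x - X)}. ereal c + log_f r X)"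
      by (rule SUP_upper2[of "(x, weighted_outer U x)"]) (use x p psd_0 in auto)
  qed
  show "lifted_relaxation c r U \<le> relaxation c r U"
    unfolding lifted_relaxation_def
  proof (rule SUP_least, clarify)
    fix x and X :: "real^'n^'n"
    assume x: "x \<in> relaxed_set r" and X: "psd X" "psd (weighted_outer U x - X)"
    have "ereal c + log_f r X \<le> ereal c + log_f r (weighted_outer U x)"
      by (intro add_left_mono log_f_mono X p x r)
    also have "\<dots> \<le> relaxation c r U" unfolding relaxation_def by (rule SUP_upper[OF x])
    finally show "ereal c + log_f r X \<le> relaxation c r U" .
  qed
qed

text \<open>Separates the variables: the supremum over \<open>X\<close> is a conjugate of
  \<open>log_f\<close> at \<open>L\<close>, and each \<open>x $ i\<close> enters linearly, with the
  slack of its dual constraint as negated coefficient.\<close>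

lemma lagrangian_finite:
  fixes U :: "real^'n^'n"
  assumes "0 < f_spec r X"
  shows "lagrangian c r U (x, X) (L, \<nu>, \<mu>) =
    ereal (c + (ln (f_spec r X) - trace (L ** X)) +
      (\<Sum>i\<in>UNIV. x $ i * (column i U \<bullet> (L *v column i U) - \<nu> - \<mu> $ i)) +
      real r * \<nu> + (\<Sum>i\<in>UNIV. \<mu> $ i))"
  using assms
  by (simp add: lagrangian_def log_f_def matrix_diff_ldistrib trace_sub trace_mult_weighted_outer
      right_diff_distrib sum_subtractf sum.distrib sum_distrib_left mult.commute algebra_simps)

lemma dual_function_feasible:
  fixes U :: "real^'n^'n"
  assumes r: "0 < r" "r \<le> CARD('n)" and p: "p \<in> dual_feasible U"
  shows "dual_function c r U p = ereal (c + dual_objective r p)"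
proof -
  obtain L \<nu> \<mu> where p': "p = (L, \<nu>, \<mu>)" by (cases p)
  have L: "pd L" and feas: "\<And>i. column i U \<bullet> (L *v column i U) \<le> \<nu> + \<mu> $ i"
    using p by (auto simp: dual_feasible_def p')
  show ?thesis unfolding dual_function_def p'
  proof (rule antisym[OF SUP_least])
    fix y :: "(real^'n) \<times> (real^'n^'n)" assume "y \<in> {(x, X). (\<forall>i. 0 \<le> x $ i) \<and> psd X}"
    then obtain x X where y: "y = (x, X)" "\<And>i. 0 \<le> x $ i" "psd X" by auto
    show "lagrangian c r U y (L, \<nu>, \<mu>) \<le> ereal (c + dual_objective r (L, \<nu>, \<mu>))"
    proof (cases "0 < f_spec r X")
      case True
      have "(\<Sum>i\<in>UNIV. x $ i * (column i U \<bullet> (L *v column i U) - \<nu> - \<mu> $ i)) \<le> 0"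
      proof (rule sum_nonpos)
        fix i show "x $ i * (column i U \<bullet> (L *v column i U) - \<nu> - \<mu> $ i) \<le> 0"
          using feas[of i] y(2)[of i] by (intro mult_nonneg_nonpos) auto
      qed
      then show ?thesis using ln_f_spec_le[OF y(3) r True L]
        unfolding y(1) lagrangian_finite[OF True] dual_objective_def by simp
    qed (simp add: y(1) lagrangian_def log_f_def)
  next
    obtain X where X: "psd X" "0 < f_spec r X" "trace (L ** X) = real r" "ln (f_spec r X) = - ln (det_least r L)"
      using conjugate_attained[OF L r] by blast
    \<comment> \<open>At a feasible multiplier all coefficients of \<open>x\<close> are nonpositive,
      so \<open>x = 0\<close> is a best choice, paired with the maximizing \<open>X\<close>.\<close>
    have "(0 :: real^'n, X) \<in> {(x, X). (\<forall>i. 0 \<le> x $ i) \<and> psd X}" using X(1) by simp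
    moreover have "ereal (c + dual_objective r (L, \<nu>, \<mu>)) \<le> lagrangian c r U (0, X) (L, \<nu>, \<mu>)"
      unfolding lagrangian_finite[OF X(2)] by (simp add: dual_objective_def X)
    ultimately show "ereal (c + dual_objective r (L, \<nu>, \<mu>)) \<le>
        (SUP y\<in>{(x, X). (\<forall>i. 0 \<le> x $ i) \<and> psd X}. lagrangian c r U y (L, \<nu>, \<mu>))"
      by (rule SUP_upper2)
  qed
qed

text \<open>There are two ways to leave the feasible set. If \<open>L\<close> is positive definite,
  some constraint is violated, and sending that \<open>x $ i\<close> to infinity is unbounded. If
  \<open>L\<close> is singular, its least eigenvalue 0 contributes \<open>- ln e\<close> to
  \<open>ln (f_spec r X)\<close> for the witness \<open>X\<close>, while
  \<open>trace (L ** X)\<close> stays at most \<open>r\<close>.\<close>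

lemma dual_function_infeasible:
  fixes U :: "real^'n^'n"
  assumes r: "0 < r" "r \<le> CARD('n)" and p: "p \<in> multipliers" "p \<notin> dual_feasible U"
  shows "dual_function c r U p = \<infinity>"
proof -
  let ?n = "CARD('n)"
  obtain L \<nu> \<mu> where p': "p = (L, \<nu>, \<mu>)" by (cases p)
  have L: "psd L" and \<mu>: "\<And>i. 0 \<le> \<mu> $ i" using p(1) by (auto simp: multipliers_def p')
  define c0 where "c0 = c + real r * \<nu> + (\<Sum>i\<in>UNIV. \<mu> $ i)"
  have "\<exists>y\<in>{(x, X). (\<forall>i. 0 \<le> x $ i) \<and> psd X}. ereal K \<le> lagrangian c r U y p" for K
  proof (cases "pd L")
    case True
    then obtain i where i: "\<nu> + \<mu> $ i < column i U \<bullet> (L *v column i U)"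
      using p(2) \<mu> by (auto simp: dual_feasible_def p' not_le)
    define d where "d = column i U \<bullet> (L *v column i U) - \<nu> - \<mu> $ i"
    obtain X :: "real^'n^'n" where X: "psd X" "0 < f_spec r X"
      using conjugate_attained[OF True r] by blast
    \<comment> \<open>Makes \<open>t * d\<close> the absolute value of the gap to \<open>K\<close>;
      this keeps \<open>t\<close>, a coordinate of \<open>x\<close>, nonnegative.\<close>
    define t where "t = \<bar>K - c0 - (ln (f_spec r X) - trace (L ** X))\<bar> / d"
    have "0 < d" using i by (simp add: d_def)
    have "(\<Sum>j\<in>UNIV. (t *\<^sub>R axis i 1 :: real^'n) $ j * (column j U \<bullet> (L *v column j U) - \<nu> - \<mu> $ j)) = t * d"
      unfolding d_def by (subst sum.remove[of _ i]) (auto simp: axis_def intro!: sum.neutral)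
    then have "lagrangian c r U (t *\<^sub>R axis i 1, X) p =
        ereal (c0 + (ln (f_spec r X) - trace (L ** X)) + t * d)"
      unfolding p' lagrangian_finite[OF X(2)] c0_def by simp
    moreover have "t * d = \<bar>K - c0 - (ln (f_spec r X) - trace (L ** X))\<bar>" using \<open>0 < d\<close> by (simp add: t_def)
    ultimately have "ereal K \<le> lagrangian c r U (t *\<^sub>R axis i 1, X) p" by simp
    moreover have "0 \<le> (t *\<^sub>R axis i 1 :: real^'n) $ j" for j
      using \<open>0 < d\<close> by (simp add: t_def axis_def)
    ultimately show ?thesis using X(1) by (intro bexI[of _ "(t *\<^sub>R axis i 1, X)"]) auto
  next
    case False
    obtain q where q: "eigenbasis L (eig L) q" and srt: "\<And>i j. 1 \<le> i \<Longrightarrow> i \<le> j \<Longrightarrow> j \<le> ?n \<Longrightarrow> eig L j \<le> eig L i"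
      using eig_sorted[of L] L by (metis psd_def)
    have "\<exists>i\<in>{1..?n}. eig L i \<le> 0"
      using pd_spectral[of q "eig L"] eigenbasis_eq_spectral[OF q] q False
      unfolding eigenbasis_def by (metis not_le)
    then obtain i where "i \<in> {1..?n}" "eig L i \<le> 0" by blast
    then have "eig L ?n \<le> 0" using srt[of i ?n] by auto
    then have zero: "eig L ?n = 0" using psd_eig_nonneg[OF L, of ?n] by simp
    define I where "I = {?n - r + 1..<?n}"
    have I: "{?n - r + 1..?n} = insert ?n I" using r by (auto simp: I_def)
    \<comment> \<open>\<open>e \<le> 1\<close> gives \<open>ln (eig L i + e) \<le> eig L i\<close>
      for the indices in \<open>I\<close>. The exponential makes \<open>- ln e\<close> cover the gap
      to \<open>K\<close>, the trace term of at most \<open>r\<close>, and those summands.\<close>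
    define e where "e = min 1 (exp (- (K - c0 + real r + sum (eig L) I)))"
    have e: "0 < e" "e \<le> 1" "ln e \<le> - (K - c0 + real r + sum (eig L) I)"
    proof -
      show "0 < e" "e \<le> 1" by (auto simp: e_def)
      have "ln e \<le> ln (exp (- (K - c0 + real r + sum (eig L) I)))"
        using \<open>0 < e\<close> by (subst ln_le_cancel_iff) (auto simp: e_def)
      then show "ln e \<le> - (K - c0 + real r + sum (eig L) I)" by simp
    qed
    have pos: "0 < eig L i + e" if "i \<in> {1..?n}" for i using psd_eig_nonneg[OF L that] e(1) by simp
    obtain X where X: "psd X" "0 < f_spec r X" "trace (L ** X) \<le> real r"
      "ln (f_spec r X) = - (\<Sum>i\<in>{?n - r + 1..?n}. ln (eig L i + e))"
      using conjugate_witness[OF L r less_imp_le[OF e(1)] pos] by blast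
    have "(\<Sum>i\<in>I. ln (eig L i + e)) \<le> sum (eig L) I"
    proof (rule sum_mono)
      fix i assume "i \<in> I"
      then have "i \<in> {1..?n}" by (auto simp: I_def)
      then show "ln (eig L i + e) \<le> eig L i" using ln_le_minus_one[OF pos, of i] e(2) by simp
    qed
    moreover have "(\<Sum>i\<in>{?n - r + 1..?n}. ln (eig L i + e)) = ln e + (\<Sum>i\<in>I. ln (eig L i + e))"
      unfolding I using zero by (subst sum.insert) (auto simp: I_def)
    ultimately have "K - c0 + real r \<le> ln (f_spec r X)" using e(3) X(4) by linarith
    then have "ereal K \<le> lagrangian c r U (0, X) p"
      unfolding p' lagrangian_finite[OF X(2)] using X(3) by (simp add: c0_def)
    then show ?thesis using X(1) by (intro bexI[of _ "(0, X)"]) auto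
  qed
  then show ?thesis unfolding dual_function_def by (intro SUP_PInfty)
qed

section \<open>Existence of a dual minimizer\<close>

lemma minorized_attains_min:
  fixes F :: "'a::topological_space \<Rightarrow> real"
  assumes "compact K" "K \<noteq> {}"
    and minorant: "\<And>p. p \<in> K \<Longrightarrow> \<exists>h. continuous_on UNIV h \<and> (\<forall>y\<in>K. h y \<le> F y) \<and> h p = F p"
  shows "\<exists>p\<in>K. \<forall>y\<in>K. F p \<le> F y"
proof (rule ccontr)
  assume "\<not> ?thesis"
  \<comment> \<open>Without a minimizer, every \<open>p\<close> has a better point
    \<open>b p\<close>. The minorant touching at \<open>p\<close> exceeds \<open>F (b p)\<close> on
    an open neighbourhood of \<open>p\<close>, so \<open>F\<close> does so too within
    \<open>K\<close>. In a finite subcover take the \<open>p\<close> with least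
    \<open>F (b p)\<close>: the neighbourhood containing \<open>b p\<close> gives a still smaller
    value.\<close>
  then obtain b where b: "\<And>p. p \<in> K \<Longrightarrow> b p \<in> K" "\<And>p. p \<in> K \<Longrightarrow> F (b p) < F p" by (metis not_le)
  obtain h where h: "\<And>p. p \<in> K \<Longrightarrow> continuous_on UNIV (h p)" "\<And>p y. p \<in> K \<Longrightarrow> y \<in> K \<Longrightarrow> h p y \<le> F y"
    "\<And>p. p \<in> K \<Longrightarrow> h p p = F p" using minorant by metis
  have "open {x. F (b p) < h p x}" if "p \<in> K" for p
    by (intro open_Collect_less h that continuous_on_const)
  moreover have "K \<subseteq> (\<Union>p\<in>K. {x. F (b p) < h p x})" using b h(3) by auto
  ultimately obtain C where C: "C \<subseteq> K" "finite C" "K \<subseteq> (\<Union>p\<in>C. {x. F (b p) < h p x})"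
    by (rule compactE_image[OF \<open>compact K\<close>, of K "\<lambda>p. {x. F (b p) < h p x}"])
  then have "C \<noteq> {}" using \<open>K \<noteq> {}\<close> by auto
  then obtain p where p: "p \<in> C" "\<And>q. q \<in> C \<Longrightarrow> F (b p) \<le> F (b q)"
    using arg_min_if_finite(1)[OF C(2), of "\<lambda>p. F (b p)"] arg_min_least[OF C(2), of _ "\<lambda>p. F (b p)"] by metis
  have "b p \<in> K" using p(1) C(1) b(1) by blast
  then obtain q where q: "q \<in> C" "F (b q) < h q (b p)" using C(3) by auto
  then have "F (b q) < F (b p)" using h(2)[of q "b p"] C(1) \<open>b p \<in> K\<close> by fastforce
  then show False using p(2)[OF q(1)] by simp
qed

lemma trace_eq_sum_eig:
  fixes L :: "real^'n^'n"
  assumes "transpose L = L"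
  shows "trace L = (\<Sum>i\<in>{1..CARD('n)}. eig L i)"
proof -
  obtain q where q: "eigenbasis L (eig L) q" using eig_sorted[of L] assms by metis
  then have "trace L = (\<Sum>i\<in>{1..CARD('n)}. q i \<bullet> (L *v q i))"
    by (intro trace_orthonormal) (simp add: eigenbasis_def)
  then show ?thesis using eigenbasis_Rayleigh[OF q] by simp
qed

text \<open>The norm is the Frobenius norm, whose square is the sum of the squared eigenvalues; for
  nonnegative numbers this is at most the square of the sum.\<close>

lemma norm_le_trace:
  fixes L :: "real^'n^'n"
  assumes L: "psd L"
  shows "norm L \<le> trace L"
proof -
  have sym: "transpose L = L" using L by (simp add: psd_def)
  obtain q where q: "eigenbasis L (eig L) q" using eig_sorted[of L] sym by metis
  have s: "L $ k $ i = L $ i $ k" for i k using sym by (simp add: transpose_def vec_eq_iff)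
  have "L \<bullet> L = (\<Sum>i\<in>UNIV. \<Sum>k\<in>UNIV. L $ i $ k * L $ i $ k)" by (simp add: inner_vec_def)
  also have "\<dots> = (\<Sum>i\<in>UNIV. \<Sum>k\<in>UNIV. L $ i $ k * L $ k $ i)"
    by (intro sum.cong refl) (simp only: s)
  also have "\<dots> = trace (L ** L)" by (simp add: trace_def matrix_matrix_mult_def)
  also have "\<dots> = (\<Sum>i\<in>{1..CARD('n)}. eig L i * eig L i)"
    unfolding trace_mult_eigenbasis[OF q] using eigenbasis_Rayleigh[OF q] by (intro sum.cong) auto
  also have "\<dots> \<le> (\<Sum>i\<in>{1..CARD('n)}. eig L i * trace L)"
    unfolding trace_eq_sum_eig[OF sym] using psd_eig_nonneg[OF L]
    by (intro sum_mono mult_left_mono member_le_sum) auto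
  also have "\<dots> = (trace L)\<^sup>2"
    by (simp add: trace_eq_sum_eig[OF sym] sum_distrib_right power2_eq_square)
  finally have "(norm L)\<^sup>2 \<le> (trace L)\<^sup>2" by (simp add: power2_norm_eq_inner)
  moreover have "0 \<le> trace L"
    unfolding trace_eq_sum_eig[OF sym] using psd_eig_nonneg[OF L] by (intro sum_nonneg) auto
  ultimately show ?thesis by (rule power2_le_imp_le)
qed

lemma eig_least_le_Rayleigh:
  fixes L :: "real^'n^'n"
  assumes "transpose L = L"
  shows "eig L (CARD('n)) * (x \<bullet> x) \<le> x \<bullet> (L *v x)"
proof -
  obtain q where q: "eigenbasis L (eig L) q"
    and srt: "\<And>i j. 1 \<le> i \<Longrightarrow> i \<le> j \<Longrightarrow> j \<le> CARD('n) \<Longrightarrow> eig L j \<le> eig L i"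
    using eig_sorted[of L] assms by metis
  have on: "orthonormal q {1..CARD('n)}" using q by (simp add: eigenbasis_def)
  have "eig L (CARD('n)) * (x \<bullet> x) = (\<Sum>i\<in>{1..CARD('n)}. eig L (CARD('n)) * (q i \<bullet> x)\<^sup>2)"
    by (subst orthonormal_inner[OF on]) (simp add: sum_distrib_left power2_eq_square)
  also have "\<dots> \<le> (\<Sum>i\<in>{1..CARD('n)}. eig L i * (q i \<bullet> x)\<^sup>2)"
    using srt by (intro sum_mono mult_right_mono) auto
  also have "\<dots> = x \<bullet> (L *v x)"
    using spectral_inner[of x "eig L" q] eigenbasis_eq_spectral[OF q] by simp
  finally show ?thesis .
qed

lemma ln_det_least_eq_sum:
  fixes L :: "real^'n^'n"
  assumes "pd L"
  shows "ln (det_least r L) = (\<Sum>i\<in>{CARD('n) - r + 1..CARD('n)}. ln (eig L i))"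
proof -
  have "eig L i \<noteq> 0" if "i \<in> {CARD('n) - r + 1..CARD('n)}" for i
    using pd_eig_pos[OF assms, of i] that by auto
  then show ?thesis unfolding det_least_def by (subst ln_prod) auto
qed

text \<open>Sums the tangent to \<open>ln\<close> at \<open>1 / b\<close>. The slope
  \<open>b\<close> is free, so the logarithm can be absorbed by any positive multiple of the
  trace.\<close>

lemma ln_det_least_le_trace:
  fixes L :: "real^'n^'n"
  assumes L: "pd L" and r: "r \<le> CARD('n)" and b: "0 < b"
  shows "ln (det_least r L) \<le> b * trace L - real r * (1 + ln b)"
proof -
  have sym: "transpose L = L" using L by (simp add: pd_def)
  have pos: "0 < eig L i" if "i \<in> {1..CARD('n)}" for i using pd_eig_pos[OF L that] .
  let ?I = "{CARD('n) - r + 1..CARD('n)}"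
  have "ln (det_least r L) \<le> (\<Sum>i\<in>?I. b * eig L i - (1 + ln b))"
    unfolding ln_det_least_eq_sum[OF L]
  proof (rule sum_mono)
    fix i assume "i \<in> ?I"
    then have "0 < eig L i" by (intro pos) auto
    then show "ln (eig L i) \<le> b * eig L i - (1 + ln b)"
      using ln_le_minus_one[of "b * eig L i"] b by (simp add: ln_mult)
  qed
  also have "\<dots> = b * (\<Sum>i\<in>?I. eig L i) - real r * (1 + ln b)"
    using r by (simp add: sum_subtractf sum_distrib_left)
  also have "(\<Sum>i\<in>?I. eig L i) \<le> trace L"
    unfolding trace_eq_sum_eig[OF sym] using less_imp_le[OF pos] by (intro sum_mono2) auto
  finally show ?thesis using b by simp
qed

text \<open>Applies \<open>ln x \<le> x\<close> to all but the least of the eigenvalues involved.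
  Together with an upper bound on the trace, a lower bound on \<open>det_least\<close> thus keeps
  the least eigenvalue away from 0.\<close>

lemma ln_det_least_le_least_eig:
  fixes L :: "real^'n^'n"
  assumes L: "pd L" and r: "0 < r" "r \<le> CARD('n)"
  shows "ln (det_least r L) \<le> ln (eig L (CARD('n))) + trace L"
proof -
  have sym: "transpose L = L" using L by (simp add: pd_def)
  have pos: "0 < eig L i" if "i \<in> {1..CARD('n)}" for i using pd_eig_pos[OF L that] .
  let ?J = "{CARD('n) - r + 1..<CARD('n)}"
  have I: "{CARD('n) - r + 1..CARD('n)} = insert (CARD('n)) ?J" using r by auto
  have "(\<Sum>i\<in>?J. ln (eig L i)) \<le> (\<Sum>i\<in>?J. eig L i)"
  proof (rule sum_mono)
    fix i assume "i \<in> ?J"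
    then have "0 < eig L i" by (intro pos) auto
    then show "ln (eig L i) \<le> eig L i" using ln_le_minus_one[of "eig L i"] by simp
  qed
  also have "\<dots> \<le> trace L"
    unfolding trace_eq_sum_eig[OF sym] using less_imp_le[OF pos] by (intro sum_mono2) auto
  finally show ?thesis unfolding ln_det_least_eq_sum[OF L] I by simp
qed

lemma continuous_on_matrix_form [continuous_intros]:
  fixes f :: "'a::topological_space \<Rightarrow> real^'n^'m"
  assumes "continuous_on S f"
  shows "continuous_on S (\<lambda>p. x \<bullet> (f p *v y))"
  unfolding inner_vec_def matrix_vector_mul_component
  by (intro continuous_intros continuous_on_component assms)

lemma continuous_on_trace_mult [continuous_intros]:
  fixes f :: "'a::topological_space \<Rightarrow> real^'n^'n"
  assumes "continuous_on S f"
  shows "continuous_on S (\<lambda>p. trace (f p ** X))"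
  unfolding trace_def matrix_matrix_mult_def vec_lambda_beta
  by (intro continuous_intros continuous_on_component assms)

text \<open>Weak duality at a fixed \<open>X\<close> bounds \<open>- ln (det_least r L)\<close> from
  below by a function affine in \<open>L\<close>; with the \<open>X\<close> that is conjugate to the
  first component of \<open>p\<close> it is tight at \<open>p\<close>.\<close>

lemma dual_minorant_exists:
  fixes p :: "(real^'n^'n) \<times> real \<times> (real^'n)"
  assumes r: "0 < r" "r \<le> CARD('n)" and p: "p \<in> dual_feasible U"
  shows "\<exists>h. continuous_on UNIV h \<and> (\<forall>y\<in>dual_feasible U. h y \<le> dual_objective r y) \<and> h p = dual_objective r p"
proof -
  obtain L \<nu> \<mu> where p': "p = (L, \<nu>, \<mu>)" by (cases p)
  then have L: "pd L" using p by (simp add: dual_feasible_def)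
  obtain X :: "real^'n^'n" where X: "psd X" "0 < f_spec r X" "trace (L ** X) = real r"
    "ln (f_spec r X) = - ln (det_least r L)"
    using conjugate_attained[OF L r] by blast
  define h where "h y = ln (f_spec r X) - trace (fst y ** X) + real r * fst (snd y) + (\<Sum>i\<in>UNIV. snd (snd y) $ i)"
    for y :: "(real^'n^'n) \<times> real \<times> (real^'n)"
  have "continuous_on UNIV h" unfolding h_def by (intro continuous_intros)
  moreover have "h y \<le> dual_objective r y" if "y \<in> dual_feasible U" for y
    using that ln_f_spec_le[OF X(1) r X(2), of "fst y"] by (auto simp: h_def dual_objective_def dual_feasible_def)
  moreover have "h p = dual_objective r p" by (simp add: h_def dual_objective_def p' X)
  ultimately show ?thesis by blast
qed

lemma column_span_eq_zero:
  fixes U :: "real^'n^'n"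
  assumes "invertible U" "\<And>i. column i U \<bullet> x = 0"
  shows "x = 0"
proof -
  have "(transpose U *v x) $ i = column i U \<bullet> x" for i
    by (simp add: matrix_vector_mul_component transpose_def column_def del: transpose_matrix_vector)
  then have "transpose U *v x = transpose U *v 0"
    using assms(2) by (simp add: vec_eq_iff del: transpose_matrix_vector)
  then show ?thesis
    using inj_matrix_vector_mult[OF transpose_invertible[OF assms(1)]] by (meson injD)
qed

lemma pd_weighted_outer:
  fixes U :: "real^'n^'n"
  assumes "invertible U" and x: "\<And>i. 0 < x $ i"
  shows "pd (weighted_outer U x)"
proof -
  have "0 < y \<bullet> (weighted_outer U x *v y)" if y: "y \<noteq> 0" for y
  proof -
    obtain i where "column i U \<bullet> y \<noteq> 0" using column_span_eq_zero[OF assms(1)] y by blast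
    then have "0 < x $ i * (column i U \<bullet> y)\<^sup>2" using x by simp
    then show ?thesis unfolding weighted_outer_inner
      using x by (intro sum_pos2[of UNIV i]) (auto intro!: mult_nonneg_nonneg less_imp_le[OF x])
  qed
  then show ?thesis by (simp add: pd_def transpose_weighted_outer)
qed

lemma dual_minimizer_exists:
  fixes U :: "real^'n^'n"
  assumes U: "invertible U" and r: "0 < r" "r < CARD('n)"
  shows "\<exists>p. is_arg_min (dual_objective r) (\<lambda>q. q \<in> dual_feasible U) p"
proof -
  let ?n = "CARD('n)"
  \<comment> \<open>The sum of all \<open>v_i v_i^T\<close>. It is positive definite because the
    columns span, and its least eigenvalue measures how strongly the summed constraints bound the
    trace.\<close>
  define G where "G = weighted_outer U (vec 1)"
  have G: "pd G" unfolding G_def by (rule pd_weighted_outer[OF U]) simp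
  define \<sigma> where "\<sigma> = eig G ?n"
  have "0 < \<sigma>" unfolding \<sigma>_def by (rule pd_eig_pos[OF G]) simp
  have trG: "\<sigma> * trace L \<le> (\<Sum>i\<in>UNIV. column i U \<bullet> (L *v column i U))" if L: "psd L" for L :: "real^'n^'n"
  proof -
    obtain q where q: "eigenbasis G (eig G) q" and srt: "\<And>i j. 1 \<le> i \<Longrightarrow> i \<le> j \<Longrightarrow> j \<le> ?n \<Longrightarrow> eig G j \<le> eig G i"
      using eig_sorted[of G] G by (metis pd_def)
    have "\<sigma> * trace L = (\<Sum>i\<in>{1..?n}. \<sigma> * (q i \<bullet> (L *v q i)))"
      using q by (subst trace_orthonormal[of q]) (simp_all add: eigenbasis_def sum_distrib_left)
    also have "\<dots> \<le> (\<Sum>i\<in>{1..?n}. eig G i * (q i \<bullet> (L *v q i)))"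
      using srt L by (intro sum_mono mult_right_mono) (auto simp: \<sigma>_def psd_def)
    also have "\<dots> = trace (L ** G)" by (rule trace_mult_eigenbasis[OF q, symmetric])
    finally show ?thesis by (simp add: G_def trace_mult_weighted_outer)
  qed
  define p0 :: "(real^'n^'n) \<times> real \<times> (real^'n)"
    where "p0 = (mat 1, \<Sum>i\<in>UNIV. column i U \<bullet> column i U, 0)"
  have "pd (mat 1 :: real^'n^'n)" by (simp add: pd_def)
  moreover have "column i U \<bullet> column i U \<le> (\<Sum>i\<in>UNIV. column i U \<bullet> column i U)" for i
    by (rule member_le_sum) auto
  ultimately have p0: "p0 \<in> dual_feasible U" by (simp add: p0_def dual_feasible_def)
  define F0 where "F0 = dual_objective r p0"
  \<comment> \<open>The summed constraints give the trace the coefficient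
    \<open>r * \<sigma> / n = 2 * b\<close> in the objective. One half absorbs
    \<open>ln (det_least r L)\<close>, the other leaves the bound
    \<open>b * T + w * M \<le> R\<close>, where \<open>T\<close> is the trace of \<open>L\<close>,
    \<open>M\<close> the sum of the \<open>\<mu> $ i\<close>, and \<open>w > 0\<close> by
    \<open>r < n\<close>.\<close>
  define b where "b = real r * \<sigma> / (2 * real ?n)"
  define w where "w = 1 - real r / real ?n"
  have "0 < b" using \<open>0 < \<sigma>\<close> r by (simp add: b_def)
  have "0 < w" using r by (simp add: w_def)
  define R where "R = F0 - real r * ln b"
  \<comment> \<open>A lower bound for the least eigenvalue on the sublevel set:
    \<open>- F0 - r * (R / w) - r\<close> bounds \<open>ln (det_least r L)\<close> from below, and
    \<open>R / b\<close> bounds the trace from above.\<close>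
  define \<delta> where "\<delta> = exp (- F0 - real r * (R / w) - real r - R / b)"
  define N where "N = \<bar>F0\<bar> + R / b + R / w"
  have bounds: "norm L \<le> R / b \<and> \<bar>\<nu>\<bar> \<le> N \<and> norm \<mu> \<le> R / w \<and> (\<forall>x. \<delta> * (x \<bullet> x) \<le> x \<bullet> (L *v x))"
    if feas: "(L, \<nu>, \<mu>) \<in> dual_feasible U" and F: "dual_objective r (L, \<nu>, \<mu>) \<le> F0" for L \<nu> \<mu>
  proof -
    have L: "pd L" and \<mu>: "\<And>i. 0 \<le> \<mu> $ i" and con: "\<And>i. column i U \<bullet> (L *v column i U) \<le> \<nu> + \<mu> $ i"
      using feas by (auto simp: dual_feasible_def)
    have sym: "transpose L = L" and psd: "psd L" using L by (auto simp: pd_def pd_imp_psd)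
    define T where "T = trace L"
    define M where "M = (\<Sum>i\<in>UNIV. \<mu> $ i)"
    define D where "D = ln (det_least r L)"
    have nT: "norm L \<le> T" unfolding T_def by (rule norm_le_trace[OF psd])
    then have "0 \<le> T" using norm_ge_zero order_trans by blast
    have "0 \<le> M" using \<mu> by (simp add: M_def sum_nonneg)
    have F': "- D + real r * \<nu> + M - real r \<le> F0"
      using F by (simp add: dual_objective_def D_def M_def)
    have "\<sigma> * T \<le> (\<Sum>i\<in>UNIV. \<nu> + \<mu> $ i)"
      unfolding T_def using trG[OF psd] sum_mono[of UNIV "\<lambda>i. column i U \<bullet> (L *v column i U)"] con
      by (meson order_trans)
    then have "\<sigma> * T \<le> real ?n * \<nu> + M" by (simp add: sum.distrib M_def)
    then have "real r / real ?n * (\<sigma> * T) \<le> real r / real ?n * (real ?n * \<nu> + M)"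
      by (intro mult_left_mono) auto
    then have 1: "2 * (b * T) \<le> real r * \<nu> + (1 - w) * M" by (simp add: b_def w_def field_simps)
    have 2: "D \<le> b * T - real r * (1 + ln b)"
      unfolding D_def T_def using r by (intro ln_det_least_le_trace[OF L _ \<open>0 < b\<close>]) simp
    have "b * T + w * M \<le> R" using 1 2 F' by (simp add: R_def algebra_simps)
    moreover have "0 \<le> b * T" "0 \<le> w * M" using \<open>0 \<le> T\<close> \<open>0 \<le> M\<close> \<open>0 < b\<close> \<open>0 < w\<close> by auto
    ultimately have "b * T \<le> R" "w * M \<le> R" by linarith+
    then have TR: "T \<le> R / b" and MR: "M \<le> R / w" using \<open>0 < b\<close> \<open>0 < w\<close> by (simp_all add: field_simps)
    have "0 \<le> \<nu> + \<mu> $ i" for i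
      using con[of i] psd order_trans unfolding psd_def by blast
    moreover have "\<mu> $ i \<le> M" for i unfolding M_def using \<mu> by (intro member_le_sum) auto
    ultimately have "0 \<le> \<nu> + M" by (meson add_left_mono order_trans)
    then have \<nu>low: "- (R / w) \<le> \<nu>" using MR by simp
    have "D \<le> T - real r"
      using ln_det_least_le_trace[OF L, of r 1] r by (simp add: D_def T_def)
    then have r\<nu>: "real r * \<nu> \<le> F0 + T" using F' \<open>0 \<le> M\<close> by linarith
    have \<nu>up: "\<nu> \<le> \<bar>F0\<bar> + R / b"
    proof (cases "0 \<le> \<nu>")
      case True
      then have "\<nu> \<le> real r * \<nu>" using r(1) mult_right_mono[of 1 "real r" \<nu>] by simp
      then show ?thesis using r\<nu> TR by linarith
    next
      case False
      then show ?thesis using \<open>0 \<le> T\<close> TR by linarith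
    qed
    have "norm \<mu> \<le> (\<Sum>i\<in>UNIV. \<bar>\<mu> $ i\<bar>)" by (rule norm_le_l1_cart)
    also have "\<dots> = M" using \<mu> by (simp add: M_def)
    finally have "norm \<mu> \<le> R / w" using MR by simp
    have "real r * (- (R / w)) \<le> real r * \<nu>" using \<nu>low by (intro mult_left_mono) auto
    then have "- F0 - real r * (R / w) - real r \<le> D" using F' \<open>0 \<le> M\<close> by simp
    moreover have "D \<le> ln (eig L ?n) + T"
      unfolding D_def T_def using r by (intro ln_det_least_le_least_eig[OF L]) auto
    ultimately have "- F0 - real r * (R / w) - real r - R / b \<le> ln (eig L ?n)" using TR by linarith
    moreover have "0 < eig L ?n" by (rule pd_eig_pos[OF L]) simp
    ultimately have "\<delta> \<le> eig L ?n" unfolding \<delta>_def by (simp add: ln_ge_iff)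
    then have "\<delta> * (x \<bullet> x) \<le> x \<bullet> (L *v x)" for x
      using eig_least_le_Rayleigh[OF sym, of x] mult_right_mono[of \<delta> "eig L ?n" "x \<bullet> x"] by fastforce
    moreover have "\<bar>\<nu>\<bar> \<le> N" unfolding N_def
      using \<nu>low \<nu>up \<open>0 \<le> M\<close> MR \<open>0 \<le> T\<close> TR by linarith
    ultimately show ?thesis using nT TR \<open>norm \<mu> \<le> R / w\<close> by auto
  qed
  \<comment> \<open>Strict definiteness is not a closed condition; the uniform bound by
    \<open>\<delta>\<close> is, it implies strictness, and every point of the sublevel set satisfies
    it.\<close>
  define Q where "Q = {p :: (real^'n^'n) \<times> real \<times> (real^'n).
      (\<forall>i j. fst p $ i $ j = fst p $ j $ i) \<and> (\<forall>x. \<delta> * (x \<bullet> x) \<le> x \<bullet> (fst p *v x)) \<and>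
      (\<forall>i. 0 \<le> snd (snd p) $ i) \<and>
      (\<forall>i. column i U \<bullet> (fst p *v column i U) \<le> fst (snd p) + snd (snd p) $ i)}"
  define K where "K = Q \<inter> (cball 0 (R / b) \<times> cball 0 N \<times> cball 0 (R / w))"
  have "closed Q" unfolding Q_def
    by (intro closed_Collect_conj closed_Collect_all closed_Collect_le closed_Collect_eq
        continuous_intros continuous_on_component)
  then have "compact K" unfolding K_def
    by (intro closed_Int_compact compact_Times compact_cball)
  have sub: "K \<subseteq> dual_feasible U"
  proof
    fix p assume "p \<in> K"
    then have "p \<in> Q" by (simp add: K_def)
    obtain L \<nu> \<mu> where p: "p = (L, \<nu>, \<mu>)" by (cases p)
    have "transpose L = L" using \<open>p \<in> Q\<close> by (simp add: Q_def p transpose_def vec_eq_iff)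
    moreover have "0 < x \<bullet> (L *v x)" if "x \<noteq> 0" for x
    proof -
      have "0 < \<delta> * (x \<bullet> x)" using that by (simp add: \<delta>_def)
      also have "\<dots> \<le> x \<bullet> (L *v x)" using \<open>p \<in> Q\<close> by (simp add: Q_def p)
      finally show ?thesis .
    qed
    ultimately show "p \<in> dual_feasible U" using \<open>p \<in> Q\<close> by (simp add: Q_def p dual_feasible_def pd_def)
  qed
  have sublevel: "p \<in> K" if "p \<in> dual_feasible U" "dual_objective r p \<le> F0" for p
  proof -
    obtain L \<nu> \<mu> where p: "p = (L, \<nu>, \<mu>)" by (cases p)
    have "transpose L = L" using that(1) by (simp add: dual_feasible_def pd_def p)
    then have "L $ i $ j = L $ j $ i" for i j by (simp add: transpose_def vec_eq_iff)
    then show ?thesis using bounds[of L \<nu> \<mu>] that by (auto simp: K_def Q_def p dual_feasible_def dist_norm)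
  qed
  have "p0 \<in> K" using sublevel[OF p0] by (simp add: F0_def)
  have "\<exists>p\<in>K. \<forall>y\<in>K. dual_objective r p \<le> dual_objective r y"
  proof (rule minorized_attains_min[OF \<open>compact K\<close>])
    show "K \<noteq> {}" using \<open>p0 \<in> K\<close> by blast
    show "\<exists>h. continuous_on UNIV h \<and> (\<forall>y\<in>K. h y \<le> dual_objective r y) \<and> h p = dual_objective r p"
      if "p \<in> K" for p
      using dual_minorant_exists[of r p U] r that sub by (meson less_imp_le subsetD)
  qed
  then obtain p where p: "p \<in> K" "\<And>y. y \<in> K \<Longrightarrow> dual_objective r p \<le> dual_objective r y" by blast
  have "dual_objective r p \<le> dual_objective r y" if "y \<in> dual_feasible U" for y
  proof (cases "dual_objective r y \<le> F0")
    case True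
    then show ?thesis using p(2) sublevel[OF that] by blast
  next
    case False
    then show ?thesis using p(2)[OF \<open>p0 \<in> K\<close>] by (simp add: F0_def)
  qed
  then show ?thesis using p(1) sub unfolding is_arg_min_def by (meson not_le subsetD)
qed

lemma lagrangian_dual_attained:
  fixes U :: "real^'n^'n"
  assumes U: "invertible U" and r: "0 < r" "r < CARD('n)"
  shows "\<exists>p. is_arg_min (dual_objective r) (\<lambda>q. q \<in> dual_feasible U) p \<and>
    lagrangian_dual c r U = ereal (c + dual_objective r p)"
proof -
  obtain p where p: "is_arg_min (dual_objective r) (\<lambda>q. q \<in> dual_feasible U) p"
    using dual_minimizer_exists[OF assms] by blast
  then have pf: "p \<in> dual_feasible U" and
    min: "\<And>q. q \<in> dual_feasible U \<Longrightarrow> dual_objective r p \<le> dual_objective r q"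
    unfolding is_arg_min_def by (auto simp: not_less)
  have df: "dual_function c r U q = ereal (c + dual_objective r q)" if "q \<in> dual_feasible U" for q
    using that r by (intro dual_function_feasible) auto
  have "lagrangian_dual c r U = ereal (c + dual_objective r p)"
    unfolding lagrangian_dual_def
  proof (rule antisym[OF INF_lower2 INF_greatest])
    show "p \<in> multipliers" using pf by (auto simp: multipliers_def dual_feasible_def pd_imp_psd)
    show "dual_function c r U p \<le> ereal (c + dual_objective r p)" using df[OF pf] by simp
    fix q :: "(real^'n^'n) \<times> real \<times> (real^'n)" assume q: "q \<in> multipliers"
    show "ereal (c + dual_objective r p) \<le> dual_function c r U q"
    proof (cases "q \<in> dual_feasible U")
      case True
      then show ?thesis using df min by simp
    next
      case False
      then show ?thesis using dual_function_infeasible[OF r(1) less_imp_le[OF r(2)] q] by simp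
    qed
  qed
  then show ?thesis using p by blast
qed

section \<open>Determinants\<close>

text \<open>The coordinate projection onto \<open>S\<close>: \<open>sel S ** M ** sel T\<close> is
  the block of \<open>M\<close> with rows \<open>S\<close> and columns \<open>T\<close>, padded by
  zeros to keep the type.\<close>

definition sel :: "'n set \<Rightarrow> real^'n^'n" where
  "sel S = (\<chi> i j. if i = j \<and> i \<in> S then 1 else 0)"

lemma sel_mult: "sel S ** sel T = sel (S \<inter> T)"
  by (simp add: sel_def matrix_matrix_mult_def vec_eq_iff if_distrib[of "\<lambda>z. z * _"] if_distribR cong: if_cong)
     (auto simp: sum.delta' intro!: sum.neutral)

lemma sel_UNIV: "sel UNIV = mat 1"
  by (simp add: sel_def mat_def vec_eq_iff)

lemma sel_empty: "sel {} = 0"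
  by (simp add: sel_def vec_eq_iff)

lemma transpose_sel: "transpose (sel S) = sel S"
  by (auto simp: sel_def transpose_def vec_eq_iff)

lemma sel_add_Compl: "sel S + sel (- S) = mat 1"
  by (auto simp: sel_def mat_def vec_eq_iff)

lemma matrix_mult_add_rdistrib: "(A + B) ** C = A ** C + B ** (C :: real^'p^'n)"
  by (simp add: matrix_matrix_mult_def vec_eq_iff distrib_right sum.distrib)

lemma matrix_diff_rdistrib: "(A - B) ** C = A ** C - B ** (C :: real^'p^'n)"
  by (simp add: matrix_matrix_mult_def vec_eq_iff left_diff_distrib sum_subtractf)

lemma sum_outer_column: "(\<Sum>i\<in>S. outer (column i A)) = A ** sel S ** transpose A"
proof -
  have "(\<Sum>i\<in>S. outer (column i A)) $ a $ b = (A ** sel S ** transpose A) $ a $ b" for a b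
  proof -
    have "(A ** sel S) $ a $ k = (if k \<in> S then A $ a $ k else 0)" for k
    proof -
      have "(A ** sel S) $ a $ k = (\<Sum>j\<in>UNIV. if j = k then (if k \<in> S then A $ a $ k else 0) else 0)"
        unfolding matrix_matrix_mult_def sel_def vec_lambda_beta by (intro sum.cong) auto
      then show ?thesis by simp
    qed
    then have "(A ** sel S ** transpose A) $ a $ b = (\<Sum>k\<in>UNIV. if k \<in> S then A $ a $ k * A $ b $ k else 0)"
      unfolding matrix_matrix_mult_def[of "A ** sel S"] transpose_def vec_lambda_beta
      by (intro sum.cong) auto
    then show ?thesis
      by (simp add: outer_def matrix_matrix_mult_def columnvector_def rowvector_def column_def
          sum.If_cases)
  qed
  then show ?thesis by (simp add: vec_eq_iff)
qed

lemma weighted_outer_indicator: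
  "weighted_outer V (\<chi> i. if i \<in> S then 1 else 0) = V ** sel S ** transpose V"
  unfolding sum_outer_column[symmetric] weighted_outer_def
  by (simp add: sum.If_cases if_distrib[of "\<lambda>z. z *\<^sub>R _"] cong: if_cong)

section \<open>Sylvester's determinant identity\<close>

lemma outer_image: "Q ** outer w ** transpose Q = outer (Q *v w)"
proof -
  have "rowvector (Q *v w) = (rowvector w ** transpose Q :: real^_^1)"
    by (metis dot_rowvector_columnvector matrix_transpose_mul transpose_columnvector)
  then show ?thesis unfolding outer_def dot_rowvector_columnvector by (simp add: matrix_mul_assoc)
qed

text \<open>Rotating \<open>w\<close> onto a coordinate axis makes the matrix diagonal.\<close>

lemma det_one_plus_outer: "det (mat 1 + outer w) = 1 + w \<bullet> w" for w :: "real^'d"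
proof -
  fix k :: 'd
  obtain f :: "real^'d \<Rightarrow> real^'d" where f: "orthogonal_transformation f" "f w = norm w *\<^sub>R axis k 1"
    using orthogonal_transformation_exists[of w "norm w *\<^sub>R axis k 1"] by auto
  define Q where "Q = matrix f"
  have Q: "orthogonal_matrix Q" "Q *v w = norm w *\<^sub>R axis k 1"
    using f by (auto simp: Q_def orthogonal_transformation_matrix matrix_works orthogonal_transformation_linear)
  have QQ: "Q ** transpose Q = mat 1" using Q(1) by (simp add: orthogonal_matrix_def)
  then have "det Q * det (transpose Q) = 1" by (metis det_I det_mul)
  then have "det (Q ** (mat 1 + outer w) ** transpose Q) = det (mat 1 + outer w)"
    by (simp add: det_mul)
  also have "Q ** (mat 1 + outer w) ** transpose Q = mat 1 + outer (Q *v w)"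
    by (simp add: matrix_add_ldistrib matrix_mult_add_rdistrib QQ outer_image)
  finally have "det (mat 1 + outer w) = det (mat 1 + outer (norm w *\<^sub>R axis k 1 :: real^'d))"
    by (simp add: Q(2))
  also have "\<dots> = (\<Prod>i\<in>UNIV. (mat 1 + outer (norm w *\<^sub>R axis k 1 :: real^'d)) $ i $ i)"
    by (rule det_diagonal)
      (auto simp: outer_def matrix_matrix_mult_def columnvector_def rowvector_def mat_def axis_def)
  also have "\<dots> = (\<Prod>i\<in>UNIV. if i = k then 1 + w \<bullet> w else 1)"
    by (rule prod.cong[OF refl])
      (auto simp: outer_def matrix_matrix_mult_def columnvector_def rowvector_def mat_def axis_def
        power2_norm_eq_inner[symmetric] power2_eq_square)
  finally show ?thesis by simp
qed

lemma outer_mult_outer_orthogonal: "u \<bullet> v = 0 \<Longrightarrow> outer u ** outer v = 0"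
  by (simp add: matrix_eq matrix_vector_mul_assoc[symmetric] outer_mult matrix_vector_mult_scaleR)

lemma matrix_sum_rdistrib: "(\<Sum>i\<in>I. F i) ** A = (\<Sum>i\<in>I. F i ** (A :: real^'p^'n))"
  by (induction I rule: infinite_finite_induct) (auto simp: matrix_mult_add_rdistrib)

text \<open>Products of outer products of orthogonal vectors vanish, so the matrix factors into
  rank-one updates of the identity.\<close>

lemma det_one_plus_sum_outer:
  fixes w :: "'i \<Rightarrow> real^'d"
  assumes "finite F" "\<And>i j. i \<in> F \<Longrightarrow> j \<in> F \<Longrightarrow> i \<noteq> j \<Longrightarrow> w i \<bullet> w j = 0"
  shows "det (mat 1 + (\<Sum>i\<in>F. outer (w i))) = (\<Prod>i\<in>F. 1 + w i \<bullet> w i)"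
  using assms
proof (induction F rule: finite_induct)
  case (insert i F)
  have "(\<Sum>j\<in>F. outer (w j)) ** outer (w i) = 0"
    unfolding matrix_sum_rdistrib using insert.hyps insert.prems
    by (intro sum.neutral ballI outer_mult_outer_orthogonal) auto
  then have "mat 1 + (\<Sum>j\<in>insert i F. outer (w j)) = (mat 1 + (\<Sum>j\<in>F. outer (w j))) ** (mat 1 + outer (w i))"
    using insert.hyps by (simp add: matrix_add_ldistrib matrix_mult_add_rdistrib add_ac)
  then show ?case using insert by (simp add: det_mul det_one_plus_outer)
qed simp

lemma psd_gram: "psd (transpose P ** P)" for P :: "real^'n^'d"
proof -
  have "x \<bullet> ((transpose P ** P) *v x) = (P *v x) \<bullet> (P *v x)" for x
    by (metis dot_lmul_matrix inner_commute matrix_vector_mul_assoc transpose_matrix_vector)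
  then show ?thesis by (simp add: psd_def matrix_transpose_mul)
qed

text \<open>On an eigenbasis of the Gram matrix the vectors \<open>P q_i\<close> are orthogonal,
  with the eigenvalues as squared lengths, and \<open>P P^T\<close> is the sum of their outer
  products. Both determinants are therefore the product of the \<open>1 + eig\<close>, although
  their sizes differ.\<close>

lemma det_one_plus_gram:
  fixes P :: "real^'n^'d"
  shows "det (mat 1 + P ** transpose P) = det (mat 1 + transpose P ** P)"
    and "0 < det (mat 1 + transpose P ** P)"
proof -
  let ?G = "transpose P ** P"
  obtain q where q: "eigenbasis ?G (eig ?G) q" using eig_sorted[of ?G] psd_gram by (metis psd_def)
  have on: "orthonormal q {1..CARD('n)}" using q by (simp add: eigenbasis_def)
  have inner: "(P *v q i) \<bullet> (P *v q j) = q i \<bullet> (?G *v q j)" for i j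
    by (metis dot_lmul_matrix inner_commute matrix_vector_mul_assoc transpose_matrix_vector)
  have "mat 1 = spectral (\<lambda>_. 1) q"
    using on by (intro eigenbasis_eq_spectral) (simp add: eigenbasis_def)
  then have "P ** transpose P = P ** spectral (\<lambda>_. 1) q ** transpose P" by (metis matrix_mul_rid)
  also have "\<dots> = (\<Sum>i\<in>{1..CARD('n)}. outer (P *v q i))"
    by (simp add: spectral_def matrix_sum_ldistrib matrix_sum_rdistrib outer_image)
  finally have "det (mat 1 + P ** transpose P) = det (mat 1 + (\<Sum>i\<in>{1..CARD('n)}. outer (P *v q i)))"
    by simp
  also have "\<dots> = (\<Prod>i\<in>{1..CARD('n)}. 1 + (P *v q i) \<bullet> (P *v q i))"
    using q by (intro det_one_plus_sum_outer) (auto simp: inner eigenbasis_def orthonormal_def)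
  also have "\<dots> = (\<Prod>i\<in>{1..CARD('n)}. 1 + eig ?G i)"
    using eigenbasis_Rayleigh[OF q] by (intro prod.cong) (auto simp: inner)
  finally have 1: "det (mat 1 + P ** transpose P) = (\<Prod>i\<in>{1..CARD('n)}. 1 + eig ?G i)" .
  have 2: "det (mat 1 + ?G) = (\<Prod>i\<in>{1..CARD('n)}. 1 + eig ?G i)"
    using eigenbasis_det[OF q, of 1 1] by simp
  show "det (mat 1 + P ** transpose P) = det (mat 1 + transpose P ** P)" using 1 2 by simp
  show "0 < det (mat 1 + transpose P ** P)" unfolding 2
    using psd_eig_nonneg[OF psd_gram, of _ P] by (intro prod_pos ballI) (simp add: add_pos_nonneg)
qed

text \<open>\<open>I + N\<close> is the square of \<open>I + N / 2\<close>, so its determinant is nonnegative; and the determinants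
  of \<open>I + N\<close> and \<open>I - N\<close> coincide, with product 1.\<close>

lemma det_one_plus_block_nilpotent:
  fixes G :: "real^'n^'n"
  shows "det (mat 1 + sel S ** G ** sel (- S)) = 1"
proof -
  define N where "N = sel S ** G ** sel (- S)"
  \<comment> \<open>A reflection for which \<open>J N J = - N\<close>; conjugating with it exchanges
    \<open>I + N\<close> and \<open>I - N\<close>.\<close>
  define J where "J = sel S - sel (- S)"
  have "sel (- S) ** sel S = 0" by (simp add: sel_mult sel_empty)
  then have NN: "N ** N = 0"
    unfolding N_def by (metis matrix_mul_assoc times0_left times0_right)
  have JJ: "J ** J = mat 1"
    unfolding J_def matrix_diff_ldistrib matrix_diff_rdistrib
    by (simp add: sel_mult sel_empty sel_add_Compl)
  have "J ** N = N"
    by (simp add: J_def N_def matrix_diff_rdistrib matrix_mul_assoc sel_mult sel_empty)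
  moreover have "N ** J = - N"
    by (simp add: J_def N_def matrix_diff_ldistrib matrix_mul_assoc[symmetric] sel_mult sel_empty)
  ultimately have "J ** (mat 1 + N) ** J = mat 1 - N"
    by (simp add: matrix_add_ldistrib matrix_mult_add_rdistrib JJ)
  moreover have "det J * det J = 1" using JJ by (metis det_I det_mul)
  ultimately have "det (mat 1 - N) = det (mat 1 + N)"
    by (metis det_mul mult.commute mult.left_commute mult_1_right)
  moreover have "(mat 1 + N) ** (mat 1 - N) = mat 1"
    by (simp add: matrix_mult_add_rdistrib matrix_diff_ldistrib NN)
  ultimately have "det (mat 1 + N) * det (mat 1 + N) = 1" by (metis det_I det_mul)
  moreover have "(mat 1 + (1/2) *\<^sub>R N) ** (mat 1 + (1/2) *\<^sub>R N) = mat 1 + N"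
    by (simp add: matrix_mult_add_rdistrib matrix_add_ldistrib matrix_scalar_ac scalar_matrix_assoc[symmetric] NN)
  then have "0 \<le> det (mat 1 + N)" by (metis det_mul zero_le_square)
  ultimately have "det (mat 1 + N) = 1"
    using power2_eq_1_iff[of "det (mat 1 + N)"] by (auto simp: power2_eq_square)
  then show ?thesis by (simp add: N_def)
qed

text \<open>\<open>I + sel S ** G\<close> differs from its compression by the factor
  \<open>I + sel S ** G ** sel (- S)\<close>, whose determinant is 1.\<close>

lemma det_one_plus_sel_compress:
  fixes G :: "real^'n^'n"
  shows "det (mat 1 + sel S ** G ** sel S) = det (mat 1 + sel S ** G)"
proof -
  let ?D = "sel S" and ?E = "sel (- S)"
  have "?D ** G ** ?E ** (?D ** G ** ?D) = ?D ** G ** (?E ** ?D) ** G ** ?D"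
    by (simp add: matrix_mul_assoc)
  then have z: "?D ** G ** ?E ** (?D ** G ** ?D) = 0" by (simp add: sel_mult sel_empty)
  have "(mat 1 + ?D ** G ** ?E) ** (mat 1 + ?D ** G ** ?D) = mat 1 + ?D ** G ** (?D + ?E)"
    by (simp add: matrix_mult_add_rdistrib matrix_add_ldistrib z add_ac)
  then have "(mat 1 + ?D ** G ** ?E) ** (mat 1 + ?D ** G ** ?D) = mat 1 + ?D ** G"
    by (simp add: sel_add_Compl)
  then show ?thesis by (metis det_mul det_one_plus_block_nilpotent mult_1)
qed

text \<open>The principal minor of \<open>M\<close> indexed by \<open>S\<close>.\<close>

definition minor :: "'n set \<Rightarrow> real^'n^'n \<Rightarrow> real" where
  "minor S M = det (sel S ** M + sel (- S))"

text \<open>With \<open>P = B ** sel S\<close> the minor is \<open>det (I + P^T P)\<close>, and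
  Sylvester's identity turns it into \<open>det (I + P P^T)\<close>, the determinant in the original
  objective after factoring out \<open>C\<close>.\<close>

lemma minor_one_plus_gram:
  fixes B :: "real^'n^'d"
  shows "minor S (mat 1 + transpose B ** B) = det (mat 1 + B ** sel S ** transpose B)"
    and "0 < minor S (mat 1 + transpose B ** B)"
proof -
  let ?G = "transpose B ** B"
  define P where "P = B ** sel S"
  have P: "transpose P ** P = sel S ** ?G ** sel S"
    by (simp add: P_def matrix_transpose_mul transpose_sel matrix_mul_assoc)
  have "sel S ** (mat 1 + ?G) + sel (- S) = mat 1 + sel S ** ?G"
    using sel_add_Compl[of S] by (simp add: matrix_add_ldistrib add_ac)
  then have m: "minor S (mat 1 + ?G) = det (mat 1 + transpose P ** P)"
    unfolding minor_def P det_one_plus_sel_compress by simp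
  have "P ** transpose P = B ** (sel S ** sel S) ** transpose B"
    by (simp add: P_def matrix_transpose_mul transpose_sel matrix_mul_assoc)
  then have "P ** transpose P = B ** sel S ** transpose B" by (simp add: sel_mult)
  then show "minor S (mat 1 + ?G) = det (mat 1 + B ** sel S ** transpose B)"
    using det_one_plus_gram(1)[of P] m by simp
  show "0 < minor S (mat 1 + ?G)" unfolding m by (rule det_one_plus_gram(2))
qed

text \<open>Multiplication by \<open>M\<close> turns the rows taken from \<open>N\<close> into unit
  rows and the unit rows into rows of \<open>M\<close>, so the two index sets trade places.\<close>

lemma minor_complement:
  fixes M :: "real^'n^'n"
  assumes "N ** M = mat 1"
  shows "minor (- S) N * det M = minor S M"
proof -
  have "(sel (- S) ** N + sel S) ** M = sel S ** M + sel (- S)"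
    by (simp add: matrix_mult_add_rdistrib matrix_mul_assoc[symmetric] assms add.commute)
  then show ?thesis unfolding minor_def double_complement by (metis det_mul)
qed

lemma minor_UNIV: "minor UNIV M = det M"
  by (simp add: minor_def sel_UNIV sel_empty)

text \<open>If exactly \<open>k\<close> of the \<open>e i\<close> are positive, the product vanishes
  at 0 to order \<open>n - k\<close>, and \<open>0 < g 0\<close> forces this order to be
  \<open>n - s\<close>. With the powers of \<open>t\<close> cancelled, both sides are continuous and
  agree for \<open>t > 0\<close>, hence at 0.\<close>

lemma prod_shift_order_of_vanishing:
  fixes e :: "nat \<Rightarrow> real" and g :: "real \<Rightarrow> real"
  assumes nonneg: "\<And>i. i \<in> {1..n} \<Longrightarrow> 0 \<le> e i"
    and srt: "\<And>i j. 1 \<le> i \<Longrightarrow> i \<le> j \<Longrightarrow> j \<le> n \<Longrightarrow> e j \<le> e i"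
    and "s \<le> n" and g: "isCont g 0" "0 < g 0"
    and eq: "\<And>t. 0 < t \<Longrightarrow> (\<Prod>i\<in>{1..n}. t + e i) = t ^ (n - s) * g t"
  shows "(\<forall>i\<in>{Suc s..n}. e i = 0) \<and> (\<Prod>i\<in>{1..s}. e i) = g 0"
proof -
  define P where "P k \<longleftrightarrow> k \<le> n \<and> (\<forall>i\<in>{Suc k..n}. e i = 0)" for k
  define k where "k = (LEAST k. P k)"
  have "P n" by (simp add: P_def)
  then have k: "P k" and min: "\<And>j. j < k \<Longrightarrow> \<not> P j"
    unfolding k_def by (auto intro: LeastI dest: not_less_Least)
  then have kn: "k \<le> n" and zero: "\<And>i. i \<in> {Suc k..n} \<Longrightarrow> e i = 0" by (auto simp: P_def)
  have pos: "0 < e i" if i: "i \<in> {1..k}" for i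
  proof -
    have "\<not> P (k - 1)" using min i by auto
    then obtain j where "j \<in> {k..n}" "e j \<noteq> 0" using i kn by (auto simp: P_def)
    then have "e k \<noteq> 0" using zero[of j] by (cases "j = k") auto
    then show ?thesis using nonneg[of k] srt[of i k] i kn by auto
  qed
  define h where "h t = (\<Prod>i\<in>{1..k}. t + e i)" for t
  have h0: "0 < h 0" unfolding h_def using pos by (intro prod_pos) auto
  have "isCont h 0" unfolding h_def by (intro continuous_intros)
  have main: "t ^ s * h t = t ^ k * g t" if t: "0 < t" for t
  proof -
    have "(\<Prod>i\<in>{1..n}. t + e i) = h t * (\<Prod>i\<in>{Suc k..n}. t + e i)"
      unfolding h_def using kn prod.ub_add_nat[of 1 k "\<lambda>i. t + e i" "n - k"] by simp
    also have "(\<Prod>i\<in>{Suc k..n}. t + e i) = (\<Prod>i\<in>{Suc k..n}. t)"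
      using zero by (intro prod.cong) auto
    finally have "t ^ (n - k) * h t = t ^ (n - s) * g t" using eq[OF t] by (simp add: mult.commute)
    then have "(t ^ s * t ^ k) * (t ^ (n - k) * h t) = (t ^ s * t ^ k) * (t ^ (n - s) * g t)" by simp
    moreover have "t ^ n = t ^ k * t ^ (n - k)" "t ^ n = t ^ s * t ^ (n - s)"
      using kn \<open>s \<le> n\<close> by (simp_all flip: power_add)
    ultimately have "t ^ n * (t ^ s * h t) = t ^ n * (t ^ k * g t)" by (metis mult.assoc mult.commute)
    then show ?thesis using t by simp
  qed
  have limit: "f 0 = f' 0" if "\<And>t. 0 < t \<Longrightarrow> f t = f' t" "isCont f 0" "isCont f' 0" for f f' :: "real \<Rightarrow> real"
  proof -
    have lim: "(f \<longlongrightarrow> f 0) (at_right 0)" "(f' \<longlongrightarrow> f' 0) (at_right 0)"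
      using that(2,3) by (auto simp: isCont_def filterlim_at_split)
    have "\<forall>\<^sub>F t in at_right 0. f' t = f t"
      by (rule eventually_mono[OF eventually_at_right_less]) (simp add: that(1))
    then have "(f \<longlongrightarrow> f' 0) (at_right 0)" using lim(2) by (simp add: tendsto_cong)
    then show ?thesis using tendsto_unique[OF _ lim(1)] by simp
  qed
  have "k = s"
  proof (rule linorder_cases[of k s])
    assume "k < s"
    have "t ^ (s - k) * h t = g t" if "0 < t" for t
    proof -
      have "t ^ s = t ^ k * t ^ (s - k)" using \<open>k < s\<close> by (simp flip: power_add)
      then show ?thesis using main[OF that] that by simp
    qed
    then have "0 ^ (s - k) * h 0 = g 0"
      by (rule limit[of "\<lambda>t. t ^ (s - k) * h t" g]) (auto intro!: continuous_intros \<open>isCont h 0\<close> g(1))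
    then show ?thesis using \<open>k < s\<close> g(2) by (simp add: power_0_left)
  next
    assume "s < k"
    have "t ^ (k - s) * g t = h t" if "0 < t" for t
    proof -
      have "t ^ k = t ^ s * t ^ (k - s)" using \<open>s < k\<close> by (simp flip: power_add)
      then show ?thesis using main[OF that] that by simp
    qed
    then have "0 ^ (k - s) * g 0 = h 0"
      by (rule limit[of "\<lambda>t. t ^ (k - s) * g t" h]) (auto intro!: continuous_intros \<open>isCont h 0\<close> g(1))
    then show ?thesis using \<open>s < k\<close> h0 by (simp add: power_0_left)
  qed
  have "h t = g t" if "0 < t" for t using main[OF that] that by (simp add: \<open>k = s\<close>)
  then have "h 0 = g 0" by (rule limit[OF _ \<open>isCont h 0\<close> g(1)])
  then show ?thesis using zero \<open>k = s\<close> by (simp add: h_def)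
qed

lemma isCont_det:
  fixes F :: "real \<Rightarrow> real^'n^'n"
  assumes "\<And>i j. isCont (\<lambda>t. F t $ i $ j) a"
  shows "isCont (\<lambda>t. det (F t)) a"
  unfolding det_def by (intro continuous_intros assms)

lemma det_sel_add_scaled:
  "det (sel S + t *\<^sub>R sel (- S) :: real^'n^'n) = t ^ (CARD('n) - card S)"
proof -
  have "det (sel S + t *\<^sub>R sel (- S) :: real^'n^'n) = (\<Prod>i\<in>UNIV. if i \<in> - S then t else 1)"
    by (subst det_diagonal) (auto simp: sel_def intro!: prod.cong)
  also have "\<dots> = t ^ card (- S)"
    by (subst prod.If_cases) (auto simp: Compl_eq)
  finally show ?thesis by (simp add: Compl_eq_Diff_UNIV card_Diff_subset)
qed

text \<open>\<open>X V = V (sel S ** M)\<close>, so \<open>X\<close> is similar to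
  \<open>sel S ** M\<close>. Pulling \<open>t\<close> out of the rows outside \<open>S\<close>
  writes \<open>det (t I + X)\<close> as \<open>t ^ (n - s)\<close> times \<open>g t\<close>, with
  \<open>g 0\<close> the minor; this determines both the rank of \<open>X\<close> and the product of
  its nonzero eigenvalues.\<close>

lemma f_spec_selection:
  fixes V M :: "real^'n^'n"
  assumes V: "transpose V ** V = M" "det V \<noteq> 0" and S: "card S = s" "0 < s" and pos: "0 < minor S M"
  shows "f_spec s (weighted_outer V (\<chi> i. if i \<in> S then 1 else 0)) = minor S M"
proof -
  let ?D = "sel S" and ?E = "sel (- S)"
  define X where "X = weighted_outer V (\<chi> i. if i \<in> S then 1 else 0)"
  have sn: "s \<le> CARD('n)" using S(1) card_mono[of UNIV S] by auto
  have X: "psd X" unfolding X_def by (rule psd_weighted_outer) simp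
  obtain q where q: "eigenbasis X (eig X) q"
    and srt: "\<And>i j. 1 \<le> i \<Longrightarrow> i \<le> j \<Longrightarrow> j \<le> CARD('n) \<Longrightarrow> eig X j \<le> eig X i"
    using eig_sorted[of X] X by (metis psd_def)
  define g where "g t = det (?D ** M + t *\<^sub>R ?D + ?E)" for t
  have "isCont g 0" unfolding g_def
    by (intro isCont_det) (simp add: vec_eq_iff)
  have prod: "(\<Prod>i\<in>{1..CARD('n)}. t + eig X i) = t ^ (CARD('n) - s) * g t" for t
  proof -
    have mat: "mat t = t *\<^sub>R (mat 1 :: real^'n^'n)" by (simp add: mat_def vec_eq_iff)
    have "(mat t + X) ** V = V ** (mat t + ?D ** M)"
      unfolding X_def weighted_outer_indicator V(1)[symmetric]
      by (simp add: matrix_add_ldistrib matrix_mult_add_rdistrib matrix_mul_assoc mat matrix_scalar_ac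
          scalar_matrix_assoc[symmetric])
    then have "det (mat t + X) * det V = det V * det (mat t + ?D ** M)" by (metis det_mul)
    then have "det (mat t + X) = det (mat t + ?D ** M)" using V(2) by simp
    also have "mat t + ?D ** M = (?D + t *\<^sub>R ?E) ** (?D ** M + t *\<^sub>R ?D + ?E)"
    proof -
      have "mat t + ?D ** M = ?D ** M + t *\<^sub>R ?D + t *\<^sub>R ?E"
        unfolding mat sel_add_Compl[of S, symmetric] by (simp add: scaleR_add_right add_ac)
      then show ?thesis
        by (simp add: matrix_add_ldistrib matrix_mult_add_rdistrib matrix_mul_assoc sel_mult sel_empty
            matrix_scalar_ac scalar_matrix_assoc[symmetric])
    qed
    finally have "det (mat t + X) = t ^ (CARD('n) - s) * g t"
      by (simp add: det_mul det_sel_add_scaled S(1) g_def)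
    then show ?thesis using eigenbasis_det[OF q, of t 1] by simp
  qed
  have g0: "g 0 = minor S M" by (simp add: g_def minor_def)
  have "(\<forall>i\<in>{Suc s..CARD('n)}. eig X i = 0) \<and> (\<Prod>i\<in>{1..s}. eig X i) = g 0"
    by (rule prod_shift_order_of_vanishing[OF psd_eig_nonneg[OF X] srt sn \<open>isCont g 0\<close> _ prod])
      (simp_all add: g0 pos)
  then have "f_spec s X = minor S M"
    using f_spec_low_rank[OF X S(2) sn] by (simp add: g0)
  then show ?thesis by (simp add: X_def)
qed

section \<open>The positive definite square root\<close>

text \<open>For an eigenvector \<open>p\<close> of \<open>S\<close> with eigenvalue
  \<open>l\<close>, the vector \<open>y = R p - l p\<close> satisfies \<open>R y = - l y\<close>. A
  positive definite \<open>R\<close> has no negative eigenvalue, so \<open>y = 0\<close>, and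
  \<open>R\<close> and \<open>S\<close> share an eigenbasis with its eigenvalues.\<close>

lemma pd_sqrt_unique:
  fixes R S :: "real^'n^'n"
  assumes R: "pd R" and S: "pd S" and eq: "R ** R = S ** S"
  shows "R = S"
proof -
  obtain p where p: "eigenbasis S (eig S) p" using eig_sorted[of S] S by (metis pd_def)
  have "R *v p i = eig S i *\<^sub>R p i" if i: "i \<in> {1..CARD('n)}" for i
  proof -
    define y where "y = R *v p i - eig S i *\<^sub>R p i"
    have Sp: "S *v p i = eig S i *\<^sub>R p i" using p i by (simp add: eigenbasis_def)
    have "R *v (R *v p i) = S *v (S *v p i)" by (simp add: matrix_vector_mul_assoc eq)
    then have "R *v y = - (eig S i *\<^sub>R y)"
      by (simp add: y_def Sp matrix_vector_mult_diff_distrib matrix_vector_mult_scaleR scaleR_diff_right)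
    then have "y \<bullet> (R *v y) = - (eig S i * (y \<bullet> y))" by simp
    moreover have "0 \<le> eig S i * (y \<bullet> y)" using pd_eig_pos[OF S i] by simp
    ultimately have "\<not> 0 < y \<bullet> (R *v y)" by linarith
    then have "y = 0" using R by (auto simp: pd_def)
    then show ?thesis by (simp add: y_def)
  qed
  then have "eigenbasis R (eig S) p" using p by (simp add: eigenbasis_def)
  then show ?thesis using eigenbasis_eq_spectral p by metis
qed

lemma pd_sqrt_exists:
  fixes C :: "real^'n^'n"
  assumes C: "pd C"
  obtains R where "pd R" "R ** R = C"
proof -
  obtain q where q: "eigenbasis C (eig C) q" using eig_sorted[of C] C by (metis pd_def)
  have on: "orthonormal q {1..CARD('n)}" using q by (simp add: eigenbasis_def)
  define R where "R = spectral (\<lambda>i. sqrt (eig C i)) q"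
  have e: "eigenbasis R (\<lambda>i. sqrt (eig C i)) q" unfolding R_def by (rule eigenbasis_spectral[OF on])
  have "pd R" unfolding R_def using pd_eig_pos[OF C] by (intro pd_spectral[OF on]) simp
  have "(R ** R) *v q i = eig C i *\<^sub>R q i" if i: "i \<in> {1..CARD('n)}" for i
  proof -
    have "R *v q i = sqrt (eig C i) *\<^sub>R q i" using e i by (simp add: eigenbasis_def)
    then show ?thesis using pd_eig_pos[OF C i]
      by (simp add: matrix_vector_mul_assoc[symmetric] matrix_vector_mult_scaleR)
  qed
  then have "eigenbasis (R ** R) (eig C) q" using on by (simp add: eigenbasis_def)
  then have "R ** R = C" using eigenbasis_eq_spectral q by metis
  with \<open>pd R\<close> show ?thesis using that by blast
qed

lemma inv_sqrt_eq:
  fixes R :: "real^'n^'n"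
  assumes "pd R"
  shows "inv_sqrt (R ** R) = matrix_inv R"
proof -
  have "(THE S. pd S \<and> S ** S = R ** R) = R"
    by (rule the_equality) (use assms pd_sqrt_unique in auto)
  then show ?thesis by (simp add: inv_sqrt_def)
qed

lemma pd_invertible:
  fixes R :: "real^'n^'n"
  assumes R: "pd R"
  shows "invertible R"
proof -
  have "x = 0" if "R *v x = 0" for x
    using that R by (auto simp: pd_def)
  then show ?thesis by (simp add: invertible_left_inverse matrix_left_invertible_ker)
qed

lemma matrix_inv_mult:
  fixes R :: "real^'n^'n"
  assumes "invertible R"
  shows "R ** matrix_inv R = mat 1" "matrix_inv R ** R = mat 1"
  using someI_ex[OF assms[unfolded invertible_def]] by (auto simp: matrix_inv_def)

text \<open>With \<open>R\<close> the square root of \<open>C\<close> one has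
  \<open>A = R B\<close>, so \<open>R\<close> can be taken out on both sides.\<close>

lemma det_factored_gram:
  fixes C :: "real^'d^'d" and A B :: "real^'n^'d"
  assumes C: "pd C" and B: "\<And>i. column i B = inv_sqrt C *v column i A"
  shows "det (C + A ** sel S ** transpose A) = det C * minor S (mat 1 + transpose B ** B)"
proof -
  obtain R where R: "pd R" "R ** R = C" using pd_sqrt_exists[OF C] by blast
  have Rinv: "inv_sqrt C = matrix_inv R" using inv_sqrt_eq[OF R(1)] R(2) by simp
  have "column i A = R *v column i B" for i
    using matrix_inv_mult(1)[OF pd_invertible[OF R(1)]] by (simp add: B Rinv matrix_vector_mul_assoc)
  then have "column i A = column i (R ** B)" for i
    by (simp add: column_def matrix_matrix_mult_def matrix_vector_mult_def)
  then have A: "A = R ** B" by (simp add: column_def vec_eq_iff)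
  have RT: "transpose R = R" using R(1) by (simp add: pd_def)
  have "C + A ** sel S ** transpose A = R ** (mat 1 + B ** sel S ** transpose B) ** R"
    by (simp add: A R(2) matrix_transpose_mul RT matrix_add_ldistrib matrix_mult_add_rdistrib matrix_mul_assoc)
  then have "det (C + A ** sel S ** transpose A) = det (R ** R) * det (mat 1 + B ** sel S ** transpose B)"
    by (simp add: det_mul)
  then show ?thesis by (simp add: R(2) minor_one_plus_gram)
qed

lemma pd_det_pos:
  fixes C :: "real^'n^'n"
  assumes C: "pd C"
  shows "0 < det C"
proof -
  obtain q where q: "eigenbasis C (eig C) q" using eig_sorted[of C] C by (metis pd_def)
  have "det C = (\<Prod>i\<in>{1..CARD('n)}. eig C i)" using eigenbasis_det[OF q, of 0 1] by simp
  then show ?thesis using pd_eig_pos[OF C] by (auto intro: prod_pos)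
qed

section \<open>Equivalence of the two problems\<close>

definition indicator_vec :: "'n set \<Rightarrow> real^'n" where
  "indicator_vec S = (\<chi> i. if i \<in> S then 1 else 0)"

lemma Z_set_eq: "Z_set k = indicator_vec ` {S :: ('n::finite) set. card S = k}"
proof -
  have sum: "(\<Sum>i\<in>UNIV. indicator_vec S $ i) = real (card S)" for S :: "'n set"
    by (simp add: indicator_vec_def sum.If_cases)
  have "x = indicator_vec {i. x $ i = 1}" if "\<And>i. x $ i \<in> {0, 1}" for x :: "real^'n"
  proof -
    have "x $ i = (if x $ i = 1 then 1 else 0)" for i using that[of i] by auto
    then show ?thesis by (simp add: indicator_vec_def vec_eq_iff)
  qed
  then show ?thesis
  proof (intro set_eqI iffI)
    fix x :: "real^'n"
    assume eq: "\<And>x :: real^'n. (\<And>i. x $ i \<in> {0, 1}) \<Longrightarrow> x = indicator_vec {i. x $ i = 1}"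
      and x: "x \<in> Z_set k"
    then have "x = indicator_vec {i. x $ i = 1}" by (intro eq) (auto simp: Z_set_def)
    moreover have "card {i. x $ i = 1} = k"
      using x sum[of "{i. x $ i = 1}"] calculation by (simp add: Z_set_def)
    ultimately show "x \<in> indicator_vec ` {S. card S = k}" by blast
  next
    fix x :: "real^'n" assume "x \<in> indicator_vec ` {S. card S = k}"
    then show "x \<in> Z_set k" using sum by (auto simp: Z_set_def indicator_vec_def)
  qed
qed

text \<open>\<open>log_f\<close> may be minus infinity, so the problems are stated over the extended
  reals; at 0/1 vectors its values turn out finite, and the maxima reduce to real ones.\<close>

lemma Max_ereal_add_const:
  fixes h :: "'i \<Rightarrow> real"
  assumes "finite I" "I \<noteq> {}"
  shows "ereal a + Max ((\<lambda>i. ereal (h i)) ` I) = ereal (Max ((\<lambda>i. a + h i) ` I))"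
proof -
  have "mono (\<lambda>y. a + y)" "mono ereal" by (auto simp: mono_def)
  then have "Max ((\<lambda>i. ereal (h i)) ` I) = ereal (Max (h ` I))" "Max ((\<lambda>i. a + h i) ` I) = a + Max (h ` I)"
    using mono_Max_commute[of ereal "h ` I"] mono_Max_commute[of "\<lambda>y. a + y" "h ` I"] assms
    by (simp_all add: image_image)
  then show ?thesis by (simp only: plus_ereal.simps)
qed

lemma log_f_selection:
  fixes V M :: "real^'n^'n"
  assumes "transpose V ** V = M" "det M \<noteq> 0" "card S = s" "0 < s" "0 < minor S M"
  shows "log_f s (weighted_outer V (indicator_vec S)) = ereal (ln (minor S M))"
proof -
  have "det (transpose V) * det V \<noteq> 0" using assms(1,2) by (metis det_mul)
  then have "f_spec s (weighted_outer V (indicator_vec S)) = minor S M"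
    unfolding indicator_vec_def using assms by (intro f_spec_selection) auto
  then show ?thesis using assms(5) by (simp add: log_f_def)
qed

theorem proposition11:
  fixes C :: "real^'d^'d"
    and A B :: "real^('n::{finite,linorder})^'d"
    and V W :: "real^('n::{finite,linorder})^('n::{finite,linorder})"
    and s :: nat
  assumes "pd C"
    and "0 < s" "s < CARD('n)"
    and "\<And>i. column i B = inv_sqrt C *v column i A"
    and "cholesky_factor V (mat 1 + transpose B ** B)"
    and "cholesky_factor W (matrix_inv (mat 1 + transpose B ** B))"
  defines "n \<equiv> CARD('n)"
    and "c \<equiv> ln (det (C + A ** transpose A))"
  shows
    "ereal (z_star C A s) =
       ereal (ln (det C)) + Max ((\<lambda>x. log_f s (weighted_outer V x)) ` Z_set s) \<and>
     ereal (z_star C A s) =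
       ereal c + Max ((\<lambda>x. log_f (n - s) (weighted_outer W x)) ` Z_set (n - s)) \<and>
     (\<forall>x\<in>Z_set s. vec 1 - x \<in> Z_set (n - s) \<and>
       ereal (ln (det C)) + log_f s (weighted_outer V x) =
       ereal c + log_f (n - s) (weighted_outer W (vec 1 - x))) \<and>
     (\<forall>U\<in>{W, V}.
       relaxation c (n - s) U = lifted_relaxation c (n - s) U \<and>
       (\<forall>p\<in>multipliers. dual_function c (n - s) U p =
          (if p \<in> dual_feasible U then ereal (c + dual_objective (n - s) p) else \<infinity>)) \<and>
       (\<exists>p. is_arg_min (dual_objective (n - s)) (\<lambda>q. q \<in> dual_feasible U) p \<and>
          lagrangian_dual c (n - s) U = ereal (c + dual_objective (n - s) p)))"
proof -
  define M where "M = mat 1 + transpose B ** B"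
  define m where "m S = minor S M" for S
  define \<I> where "\<I> = {S :: 'n set. card S = s}"
  have r: "0 < n - s" "n - s < CARD('n)" using assms(2,3) by (auto simp: n_def)
  have mpos: "0 < m S" for S unfolding m_def M_def by (rule minor_one_plus_gram(2))
  have detM: "det M = m UNIV" by (simp add: m_def minor_UNIV)
  then have Mpos: "0 < det M" using mpos by simp
  have Minv: "matrix_inv M ** M = mat 1"
    using Mpos by (intro matrix_inv_mult) (simp add: invertible_det_nz)
  then have iM: "det (matrix_inv M) * det M = 1" by (metis det_I det_mul)
  then have "det (matrix_inv M) \<noteq> 0" by auto
  have V: "transpose V ** V = M" and W: "transpose W ** W = matrix_inv M"
    using assms(5,6) by (auto simp: cholesky_factor_def M_def)
  have compl: "minor (- S) (matrix_inv M) = m S / det M" for S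
    using minor_complement[OF Minv, of S] Mpos by (simp add: m_def field_simps)
  have detC: "0 < det C" by (rule pd_det_pos[OF assms(1)])
  have gram: "det (C + A ** sel S ** transpose A) = det C * m S" for S
    unfolding m_def M_def by (rule det_factored_gram[OF assms(1,4)])
  then have c: "c = ln (det C) + ln (det M)"
    using gram[of UNIV] detC Mpos by (simp add: c_def sel_UNIV detM[symmetric] ln_mult_pos)
  have card_Compl: "card (- S) = n - card S" for S :: "'n set"
    by (simp add: n_def Compl_eq_Diff_UNIV card_Diff_subset)
  have logV: "log_f s (weighted_outer V (indicator_vec S)) = ereal (ln (m S))" if "S \<in> \<I>" for S
    unfolding m_def
    by (rule log_f_selection[OF V]) (use that assms(2) Mpos mpos[of S] in \<open>auto simp: \<I>_def m_def\<close>)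
  \<comment> \<open>By Jacobi's identity the term \<open>ln (det M)\<close> subtracted here is
    exactly what \<open>c\<close> adds to \<open>ln (det C)\<close>, so the two objectives agree for
    each \<open>S\<close>.\<close>
  have logW: "log_f (n - s) (weighted_outer W (indicator_vec (- S))) = ereal (ln (m S) - ln (det M))"
    if "S \<in> \<I>" for S
  proof -
    have "log_f (n - s) (weighted_outer W (indicator_vec (- S))) = ereal (ln (minor (- S) (matrix_inv M)))"
      using that r mpos[of S] Mpos
      by (intro log_f_selection[OF W \<open>det (matrix_inv M) \<noteq> 0\<close>]) (auto simp: \<I>_def card_Compl compl)
    then show ?thesis using mpos[of S] Mpos by (simp add: compl ln_div)
  qed
  obtain S\<^sub>0 :: "'n set" where "card S\<^sub>0 = s"
    using obtain_subset_with_card_n[of s "UNIV :: 'n set"] assms(3) by auto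
  then have fin: "finite \<I>" "\<I> \<noteq> {}" by (auto simp: \<I>_def)
  have Zs: "Z_set s = indicator_vec ` \<I>" by (simp add: Z_set_eq \<I>_def)
  have "{T :: 'n set. card T = n - s} = uminus ` \<I>"
  proof (intro set_eqI iffI)
    fix T :: "'n set" assume "T \<in> {T. card T = n - s}"
    then have "- T \<in> \<I>" using assms(3) by (simp add: \<I>_def card_Compl n_def)
    then show "T \<in> uminus ` \<I>" by (intro image_eqI[of _ _ "- T"]) auto
  qed (auto simp: \<I>_def card_Compl)
  then have Zns: "Z_set (n - s) = (\<lambda>S. indicator_vec (- S)) ` \<I>" by (simp add: Z_set_eq image_image)
  have compl_vec: "vec 1 - indicator_vec S = indicator_vec (- S)" for S :: "'n set"
    by (auto simp: indicator_vec_def vec_eq_iff)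
  have z: "z_star C A s = Max ((\<lambda>S. ln (det C) + ln (m S)) ` \<I>)"
    using detC mpos by (simp add: z_star_def sum_outer_column gram \<I>_def ln_mult_pos)
  have "ereal (ln (det C)) + Max ((\<lambda>x. log_f s (weighted_outer V x)) ` Z_set s) = ereal (z_star C A s)"
    unfolding z Max_ereal_add_const[OF fin, symmetric] Zs image_image
    by (intro arg_cong2[of _ _ _ _ "(+)"] arg_cong[of _ _ Max] image_cong refl logV)
  moreover
  have "ereal c + Max ((\<lambda>x. log_f (n - s) (weighted_outer W x)) ` Z_set (n - s)) =
      ereal c + Max ((\<lambda>S. ereal (ln (m S) - ln (det M))) ` \<I>)"
    unfolding Zns image_image
    by (intro arg_cong2[of _ _ _ _ "(+)"] arg_cong[of _ _ Max] image_cong refl logW)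
  then have "ereal c + Max ((\<lambda>x. log_f (n - s) (weighted_outer W x)) ` Z_set (n - s)) = ereal (z_star C A s)"
    unfolding z Max_ereal_add_const[OF fin] by (simp add: c add.commute)
  moreover have "vec 1 - x \<in> Z_set (n - s) \<and>
       ereal (ln (det C)) + log_f s (weighted_outer V x) =
       ereal c + log_f (n - s) (weighted_outer W (vec 1 - x))" if x: "x \<in> Z_set s" for x
  proof -
    obtain S where "S \<in> \<I>" "x = indicator_vec S" using x Zs by auto
    moreover have "vec 1 - x = indicator_vec (- S)" unfolding \<open>x = indicator_vec S\<close> by (rule compl_vec)
    ultimately show ?thesis by (simp add: Zns logV logW c)
  qed
  moreover have "relaxation c (n - s) U = lifted_relaxation c (n - s) U \<and>
       (\<forall>p\<in>multipliers. dual_function c (n - s) U p =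
          (if p \<in> dual_feasible U then ereal (c + dual_objective (n - s) p) else \<infinity>)) \<and>
       (\<exists>p. is_arg_min (dual_objective (n - s)) (\<lambda>q. q \<in> dual_feasible U) p \<and>
          lagrangian_dual c (n - s) U = ereal (c + dual_objective (n - s) p))" if "U \<in> {W, V}" for U
  proof -
    \<comment> \<open>The factor enters the duality through its invertibility, which the determinant
      of \<open>transpose U ** U\<close> yields for \<open>V\<close> and \<open>W\<close>
      alike.\<close>
    have "transpose U ** U \<in> {matrix_inv M, M}" using that V W by auto
    then have "det (transpose U ** U) \<noteq> 0" using Mpos \<open>det (matrix_inv M) \<noteq> 0\<close> by auto
    then have "invertible U" by (simp add: invertible_det_nz det_mul)
    then show ?thesis
      using relaxation_eq_lifted[OF r(1) less_imp_le[OF r(2)]]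
        dual_function_feasible[OF r(1) less_imp_le[OF r(2)]]
        dual_function_infeasible[OF r(1) less_imp_le[OF r(2)]]
        lagrangian_dual_attained[OF _ r] by auto
  qed
  ultimately show ?thesis by auto
qed

end
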